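(* Let $\Lambda=M\mathbb{Z}^d\subset\mathbb{R}^d$ be a full lattice with dual lattice $\Lambda^*$ and fundamental domain $\Pi_\Lambda$, and let $\Omega\subset\mathbb{R}^d$ be a measurable set with $0<|\Omega|<\infty$ that is a $k$-tile for $\Lambda$ and is weakly $(v,q)$-admissible for some $v\in\mathbb{R}^d$ and $q\in\mathbb{Z}_+^d$. Let $\delta\in\mathbb{R}^{d\times d}$ be the diagonal matrix with $\delta_{ll}=v_l/q_l$, $1\leq l\leq d$, and let $\eta\in\Lambda^*$ be arbitrary. For almost every $x\in\Pi_\Lambda$ put $\mathcal{M}^d(x)=\Lambda_x$, define the lattice shifts $$\{a_s(x)\}_{s=1}^k=\{\delta j_s+\eta \mid j_s\in\mathcal{K}^d(\mathcal{M}^d(x))\},$$ and let $L(x)=\bigcup_{s=1}^k(\Lambda^*+a_s(x))$. Then for almost every $y\in\Omega$, writing $x\in\Pi_\Lambda$ for the point with $y-x\in\Lambda$, the value $f(y)$ of a function $f\in L^2(\Omega)$ is uniquely determined by the data $\{\langle f,e_l\rangle\}_{l\in L(x)}$; that is, for all $f,h\in L^2(\Omega)$ and for almost every $y\in\Omega$, if $\langle f,e_l\rangle=\langle h,e_l\rangle$ for all $l\in L(x)$, then $f(y)=h(y)$.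
   Context: Lattice notation: $M\in\mathbb{R}^{d\times d}$ is invertible, $\Lambda=M\mathbb{Z}^d$, $\Lambda^*=M^{-T}\mathbb{Z}^d$, $\Pi_\Lambda=M[0,1)^d$. Also $e_l(x)=e^{2\pi i l\cdot x}$ and $\langle f,g\rangle=\int_\Omega f\overline{g}\,dx$. $k$-tile: $\Omega$ is a $k$-tile for $\Lambda$ if $\sum_{\lambda\in\Lambda}\chi_\Omega(x-\lambda)=k$ for almost every $x\in\mathbb{R}^d$. Set $\Lambda_x=\{\lambda\in\Lambda\mid x+\lambda\in\Omega\}$; then $\#\Lambda_x=k$ for almost every $x\in\Pi_\Lambda$. Sets attached to a finite nonempty set $\mathcal{M}^d\subset\mathbb{R}^d$ ($\#$ denotes cardinality): for $1\leq l\leq d$, $\mathcal{M}^l\subset\mathbb{R}^l$ is the set of all $m\in\mathbb{R}^l$ such that $(m,m')\in\mathcal{M}^d$ for some $m'\in\mathbb{R}^{d-l}$ (the projection onto the first $l$ coordinates). Put $\mathcal{Z}^1_1=\mathcal{M}^1$. For $l\geq2$, enumerate $\mathcal{M}^{l-1}=\{m_1,m_2,\dots\}$ and set $\mathcal{Z}^l_i=\{z\in\mathbb{R}\mid (m_i,z)\in\mathcal{M}^l\}$, where the enumeration is chosen so that $\#\mathcal{Z}^l_i\leq\#\mathcal{Z}^l_j$ for $i\leq j$ (ties broken arbitrarily). Shift index set: for a finite nonempty set $S\subset\mathbb{R}^l$, the set $\mathcal{K}^l(S)\subset\mathbb{Z}^l$ is defined recursively. For $l=1$, $\mathcal{K}^1(S)=\{0,\dots,\#S-1\}$.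 For $l\geq2$, let $S'\subset\mathbb{R}^{l-1}$ be the projection of $S$ onto the first $l-1$ coordinates, enumerated as $S'=\{m_1,\dots,m_N\}$ so that the numbers $n_i=\#\{z\in\mathbb{R}\mid(m_i,z)\in S\}$ are nondecreasing in $i$; set $S'_i=\{m_j\mid j\geq i\}$, $\mathcal{Q}_1(S)=\{0,\dots,n_1-1\}$, and $\mathcal{Q}_i(S)=\{n_{i-1},\dots,n_i-1\}$ for $i\geq2$ (empty if $n_{i-1}=n_i$); then $$\mathcal{K}^l(S)=\bigcup_{i=1}^{N}\mathcal{K}^{l-1}(S'_i)\times\mathcal{Q}_i(S).$$ One has $\#\mathcal{K}^l(S)=\#S$. Weak admissibility: for $v\in\mathbb{R}^d$ and $q\in\mathbb{Z}_+^d$ (positive integer entries), a $k$-tile $\Omega$ for $\Lambda$ is weakly $(v,q)$-admissible if for almost every $x\in\Pi_\Lambda$, with $\mathcal{M}^d=\Lambda_x$, $$\#\{v_lz_l \bmod q_l\mid z_l\in\mathcal{Z}^l_p\}=\#\mathcal{Z}^l_p,\qquad 1\leq p\leq N_{l-1},\ 1\leq l\leq d,$$ where $N_0=1$ and $N_l=\#\mathcal{M}^l$ for $1\leq l\leq d$; i.e. the real numbers $v_lz_l$, $z_l\in\mathcal{Z}^l_p$, are pairwise distinct modulo $q_l$. *)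

theory Defs
  imports "HOL-Analysis.Analysis" "HOL-Library.Real_Mod"
begin

text \<open>
  The ambient space is \<open>real ^ 'd\<close>, where the order of the coordinates is given by the linear
  order on the (finite) index type \<open>'d\<close>. The combinatorial constructions relate spaces of
  different dimensions, so there a point of an \<open>l\<close>-dimensional space is a list of length \<open>l\<close>;
  \<open>coords\<close> is the translation.
\<close>

definition coords :: "'a ^ 'd::{finite,wellorder} \<Rightarrow> 'a list" where
  "coords x = map (($) x) (sorted_list_of_set UNIV)"


subsection \<open>Lattices and tilings\<close>

definition lattice_of :: "real ^ 'd ^ 'd \<Rightarrow> (real ^ 'd) set" where
  "lattice_of M = (\<lambda>z. M *v z) ` {z. \<forall>i. z $ i \<in> \<int>}"

definition dual_lattice_of :: "real ^ 'd ^ 'd \<Rightarrow> (real ^ 'd) set" where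
  "dual_lattice_of M = lattice_of (transpose (matrix_inv M))"

definition fund_domain :: "real ^ 'd ^ 'd \<Rightarrow> (real ^ 'd) set" where
  "fund_domain M = (\<lambda>t. M *v t) ` {t. \<forall>i. 0 \<le> t $ i \<and> t $ i < 1}"

definition k_tile :: "nat \<Rightarrow> real ^ 'd ^ 'd \<Rightarrow> (real ^ 'd) set \<Rightarrow> bool" where
  "k_tile k M \<Omega> \<longleftrightarrow>
     (AE x in lebesgue. ((\<lambda>l. indicat_real \<Omega> (x - l)) has_sum real k) (lattice_of M))"

definition lattice_section :: "real ^ 'd ^ 'd \<Rightarrow> (real ^ 'd) set \<Rightarrow> real ^ 'd \<Rightarrow> (real ^ 'd) set" where
  "lattice_section M \<Omega> x = {l \<in> lattice_of M. x + l \<in> \<Omega>}"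


subsection \<open>Projections, fibers and the shift index set\<close>

definition fiber :: "real list set \<Rightarrow> real list \<Rightarrow> real set" where
  "fiber S m = {z. m @ [z] \<in> S}"

text \<open>Admissible enumerations of the projection \<open>butlast ` S\<close> of \<open>S\<close> to all but the last
  coordinate: the fiber sizes are nondecreasing.\<close>

definition is_fiber_enum :: "real list set \<Rightarrow> real list list \<Rightarrow> bool" where
  "is_fiber_enum S ms \<longleftrightarrow>
     distinct ms \<and> set ms = butlast ` S \<and> sorted (map (\<lambda>m. card (fiber S m)) ms)"

text \<open>An arbitrary choice among ties. The choice is irrelevant; see
  \<open>shift_index_enum\<close> and \<open>fiber_set_fibers\<close> below.\<close>

definition fiber_enum :: "real list set \<Rightarrow> real list list" where
  "fiber_enum S = (SOME ms. is_fiber_enum S ms)"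

text \<open>List indices start at 0, so \<open>ms ! i\<close> is the point with number \<open>i + 1\<close> of the enumeration,
  and \<open>level_set S ms i\<close> is the set \<open>\<Q>\<close> with that number.\<close>

definition level_set :: "real list set \<Rightarrow> real list list \<Rightarrow> nat \<Rightarrow> nat set" where
  "level_set S ms i =
     {(if i = 0 then 0 else card (fiber S (ms ! (i - 1)))) ..< card (fiber S (ms ! i))}"

text \<open>The dimension 0 does not occur in the construction; its value is a dummy.\<close>

fun shift_index :: "nat \<Rightarrow> real list set \<Rightarrow> int list set" where
  "shift_index 0 S = {}"
| "shift_index (Suc 0) S = {[int t] | t. t < card S}"
| "shift_index (Suc (Suc l)) S =
     (let ms = fiber_enum S in
      \<Union>i<length ms. {j @ [int t] | j t.
         j \<in> shift_index (Suc l) (set (drop i ms)) \<and> t \<in> level_set S ms i})"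


subsection \<open>Weak admissibility\<close>

text \<open>For \<open>S\<close> a set of points of dimension \<open>d \<ge> l\<close>, \<open>take l ` S\<close> is the projection to the first
  \<open>l\<close> coordinates. For \<open>l = 1\<close> the enumeration in \<open>fiber_set\<close> is that of the one-point set
  \<open>{[]}\<close>, and \<open>fiber_set S 1 1\<close> is the whole projection to the first coordinate.\<close>

definition num_points :: "real list set \<Rightarrow> nat \<Rightarrow> nat" where
  "num_points S l = (if l = 0 then 1 else card (take l ` S))"

definition fiber_set :: "real list set \<Rightarrow> nat \<Rightarrow> nat \<Rightarrow> real set" where
  "fiber_set S l p = fiber (take l ` S) (fiber_enum (take l ` S) ! (p - 1))"

definition weakly_admissible ::
  "real ^ 'd::{finite,wellorder} \<Rightarrow> nat ^ 'd::_ \<Rightarrow> real ^ 'd::_ ^ 'd::_ \<Rightarrow> (real ^ 'd::_) set \<Rightarrow> bool" where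
  "weakly_admissible v q M \<Omega> \<longleftrightarrow>
     (AE x\<in>fund_domain M in lebesgue.
        let S = coords ` lattice_section M \<Omega> x in
        \<forall>l\<in>{1..CARD('d)}. \<forall>p\<in>{1..num_points S (l - 1)}.
          card ((\<lambda>z. (coords v ! (l - 1) * z) rmod real (coords q ! (l - 1))) ` fiber_set S l p)
            = card (fiber_set S l p))"


subsection \<open>Lattice shifts and Fourier coefficients\<close>

definition shift_matrix :: "real ^ 'd \<Rightarrow> nat ^ 'd \<Rightarrow> real ^ 'd ^ 'd" where
  "shift_matrix v q = (\<chi> i j. if i = j then v $ i / real (q $ i) else 0)"

definition lattice_shifts ::
  "real ^ 'd::{finite,wellorder} \<Rightarrow> nat ^ 'd::_ \<Rightarrow> real ^ 'd::_ \<Rightarrow> real ^ 'd::_ ^ 'd::_ \<Rightarrow> (real ^ 'd::_) set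
    \<Rightarrow> real ^ 'd::_ \<Rightarrow> (real ^ 'd::_) set" where
  "lattice_shifts v q \<eta> M \<Omega> x =
     {shift_matrix v q *v (\<chi> i. real_of_int (j $ i)) + \<eta> | j :: int ^ 'd::_.
        coords j \<in> shift_index CARD('d) (coords ` lattice_section M \<Omega> x)}"

definition frequencies ::
  "real ^ 'd::{finite,wellorder} \<Rightarrow> nat ^ 'd::_ \<Rightarrow> real ^ 'd::_ \<Rightarrow> real ^ 'd::_ ^ 'd::_ \<Rightarrow> (real ^ 'd::_) set
    \<Rightarrow> real ^ 'd::_ \<Rightarrow> (real ^ 'd::_) set" where
  "frequencies v q \<eta> M \<Omega> x =
     (\<Union>a\<in>lattice_shifts v q \<eta> M \<Omega> x. {\<mu> + a | \<mu>. \<mu> \<in> dual_lattice_of M})"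

definition exponential :: "real ^ 'd \<Rightarrow> real ^ 'd \<Rightarrow> complex" where
  "exponential l x = exp (2 * of_real pi * \<i> * of_real (l \<bullet> x))"

text \<open>Elements of \<open>L\<^sup>2(\<Omega>)\<close> are represented by functions; only their values on \<open>\<Omega>\<close> matter.\<close>

definition square_integrable_on :: "(real ^ 'd \<Rightarrow> complex) \<Rightarrow> (real ^ 'd) set \<Rightarrow> bool"
    (infixl \<open>square'_integrable'_on\<close> 50) where
  "f square_integrable_on \<Omega> \<longleftrightarrow>
     f \<in> borel_measurable (lebesgue_on \<Omega>) \<and> integrable (lebesgue_on \<Omega>) (\<lambda>x. (cmod (f x))\<^sup>2)"

definition inner_on ::
  "(real ^ 'd) set \<Rightarrow> (real ^ 'd \<Rightarrow> complex) \<Rightarrow> (real ^ 'd \<Rightarrow> complex) \<Rightarrow> complex" where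
  "inner_on \<Omega> f g = (\<integral>x. f x * cnj (g x) \<partial>lebesgue_on \<Omega>)"


subsection \<open>Independence of the chosen enumerations\<close>

lemma fiber_enum_exists:
  assumes "finite S"
  shows "\<exists>ms. is_fiber_enum S ms"
proof -
  have fin: "finite (butlast ` S)"
    using assms by simp
  obtain xs where xs: "set xs = butlast ` S" "distinct xs"
    using finite_distinct_list[OF fin] by blast
  have "is_fiber_enum S (sort_key (\<lambda>m. card (fiber S m)) xs)"
    unfolding is_fiber_enum_def using xs by simp
  then show ?thesis by blast
qed

lemma is_fiber_enum_fiber_enum: "finite S \<Longrightarrow> is_fiber_enum S (fiber_enum S)"
  unfolding fiber_enum_def by (rule someI_ex) (rule fiber_enum_exists)

lemma drop_fiber_enum:
  assumes ms: "is_fiber_enum S ms" and i: "i < length ms" and t: "t \<in> level_set S ms i"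
  shows "set (drop i ms) = {m \<in> butlast ` S. t < card (fiber S m)}"
proof -
  let ?n = "\<lambda>j. card (fiber S (ms ! j))"
  have mono: "?n a \<le> ?n b" if "a \<le> b" "b < length ms" for a b
    using ms that unfolding is_fiber_enum_def
    by (auto simp: sorted_iff_nth_mono dest!: spec[of _ a])
  have hi: "t < ?n i" and lo: "i \<noteq> 0 \<Longrightarrow> ?n (i - 1) \<le> t"
    using t by (auto simp: level_set_def split: if_splits)
  have iff: "t < ?n j \<longleftrightarrow> i \<le> j" if j: "j < length ms" for j
  proof
    assume a: "t < ?n j"
    show "i \<le> j"
    proof (rule ccontr)
      assume "\<not> i \<le> j"
      then have "?n j \<le> ?n (i - 1)" "i \<noteq> 0"
        using mono[of j "i - 1"] i by auto
      then show False using lo a by linarith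
    qed
  next
    assume "i \<le> j"
    then show "t < ?n j" using mono[OF _ j] hi order_less_le_trans by blast
  qed
  have "set (drop i ms) = {ms ! j | j. i \<le> j \<and> j < length ms}"
  proof (intro equalityI subsetI)
    fix m assume "m \<in> set (drop i ms)"
    then obtain a where "a < length ms - i" "m = ms ! (i + a)"
      using i by (auto simp: in_set_conv_nth)
    then show "m \<in> {ms ! j | j. i \<le> j \<and> j < length ms}"
      by (auto intro!: exI[of _ "i + a"])
  next
    fix m assume "m \<in> {ms ! j | j. i \<le> j \<and> j < length ms}"
    then obtain j where j: "m = ms ! j" "i \<le> j" "j < length ms" by blast
    then show "m \<in> set (drop i ms)"
      by (auto simp: in_set_conv_nth intro!: exI[of _ "j - i"])
  qed
  also have "\<dots> = {m \<in> set ms. t < card (fiber S m)}"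
    using iff by (auto simp: in_set_conv_nth)
  finally show ?thesis using ms by (simp add: is_fiber_enum_def)
qed

lemma level_set_cover:
  assumes ms: "is_fiber_enum S ms" and m: "m \<in> butlast ` S" "t < card (fiber S m)"
  shows "\<exists>i<length ms. t \<in> level_set S ms i"
proof -
  let ?P = "\<lambda>j. j < length ms \<and> t < card (fiber S (ms ! j))"
  have "\<exists>j. ?P j"
    using ms m unfolding is_fiber_enum_def by (metis in_set_conv_nth)
  then have L: "?P (LEAST j. ?P j)" by (rule LeastI_ex)
  moreover have "\<not> ?P ((LEAST j. ?P j) - 1)" if "(LEAST j. ?P j) \<noteq> 0"
    using that by (intro not_less_Least) simp
  ultimately show ?thesis
    by (intro exI[of _ "LEAST j. ?P j"]) (auto simp: level_set_def)
qed

lemma shift_index_union_eq: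
  assumes ms: "is_fiber_enum S ms"
  shows "(\<Union>i<length ms. {j @ [int t] | j t. j \<in> F (set (drop i ms)) \<and> t \<in> level_set S ms i}) =
    {j @ [int t] | j t. (\<exists>m\<in>butlast ` S. t < card (fiber S m)) \<and>
       j \<in> F {m \<in> butlast ` S. t < card (fiber S m)}}" (is "?L = ?R")
proof (intro equalityI subsetI)
  fix y assume "y \<in> ?L"
  then obtain i j t where *: "i < length ms" "y = j @ [int t]" "j \<in> F (set (drop i ms))"
      "t \<in> level_set S ms i" by blast
  have d: "set (drop i ms) = {m \<in> butlast ` S. t < card (fiber S m)}"
    using drop_fiber_enum[OF ms *(1,4)] .
  have "set (drop i ms) \<noteq> {}" using *(1) by simp
  then have "\<exists>m\<in>butlast ` S. t < card (fiber S m)" unfolding d by blast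
  then show "y \<in> ?R" using *(2,3) unfolding d by blast
next
  fix y assume "y \<in> ?R"
  then obtain j t m where *: "y = j @ [int t]" "m \<in> butlast ` S" "t < card (fiber S m)"
      "j \<in> F {m \<in> butlast ` S. t < card (fiber S m)}" by blast
  obtain i where i: "i < length ms" "t \<in> level_set S ms i"
    using level_set_cover[OF ms *(2,3)] by blast
  have "j \<in> F (set (drop i ms))"
    using *(4) drop_fiber_enum[OF ms i] by simp
  then show "y \<in> ?L" using *(1) i by blast
qed

lemma shift_index_enum:
  assumes "finite S" and "is_fiber_enum S ms"
  shows "shift_index (Suc (Suc l)) S =
     (\<Union>i<length ms. {j @ [int t] | j t.
         j \<in> shift_index (Suc l) (set (drop i ms)) \<and> t \<in> level_set S ms i})"
  using shift_index_union_eq[OF assms(2), of "shift_index (Suc l)"]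
    shift_index_union_eq[OF is_fiber_enum_fiber_enum[OF assms(1)], of "shift_index (Suc l)"]
  by (simp add: Let_def)

text \<open>The sets \<open>fiber_set S l p\<close> are exactly the fibers over the points of the previous projection.\<close>

lemma fiber_set_fibers:
  assumes S: "finite S" "S \<noteq> {}" "\<And>x. x \<in> S \<Longrightarrow> length x = d" and l: "1 \<le> l" "l \<le> d"
  shows "fiber_set S l ` {1..num_points S (l - 1)} = fiber (take l ` S) ` (take (l - 1) ` S)"
proof -
  let ?ms = "fiber_enum (take l ` S)"
  have e: "is_fiber_enum (take l ` S) ?ms"
    by (rule is_fiber_enum_fiber_enum) (use S in simp)
  have "butlast (take l x) = take (l - 1) x" if "x \<in> S" for x
    using S(3)[OF that] l by (simp add: butlast_take)
  then have b: "butlast ` take l ` S = take (l - 1) ` S"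
    by (force simp: image_iff)
  have sm: "set ?ms = take (l - 1) ` S" and ds: "distinct ?ms"
    using e b by (auto simp: is_fiber_enum_def)
  have "take 0 ` S = {[]}" using S(2) by auto
  then have "num_points S (l - 1) = card (take (l - 1) ` S)"
    by (auto simp: num_points_def)
  then have n: "num_points S (l - 1) = length ?ms"
    using distinct_card[OF ds] sm by simp
  have "(\<lambda>p. ?ms ! (p - 1)) ` {1..length ?ms} = set ?ms"
  proof (intro equalityI subsetI)
    fix m assume "m \<in> (\<lambda>p. ?ms ! (p - 1)) ` {1..length ?ms}"
    then show "m \<in> set ?ms" by (auto intro!: nth_mem)
  next
    fix m assume "m \<in> set ?ms"
    then obtain a where "a < length ?ms" "m = ?ms ! a"
      by (auto simp: in_set_conv_nth)
    then show "m \<in> (\<lambda>p. ?ms ! (p - 1)) ` {1..length ?ms}"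
      by (intro image_eqI[of _ _ "Suc a"]) auto
  qed
  then have "(fiber (take l ` S) ` (\<lambda>p. ?ms ! (p - 1)) ` {1..length ?ms}) =
      fiber (take l ` S) ` (take (l - 1) ` S)"
    using sm by simp
  then show ?thesis
    unfolding n fiber_set_def image_image .
qed

end

theory Submission
  imports Defs
begin

text \<open>
  Only countably many finite sets \<open>S\<close> occur as sections \<open>\<Lambda>\<^sub>x\<close>, so \<open>S\<close> can be fixed. On the set of
  \<open>x\<close> with section \<open>S\<close>, the vanishing of the Fourier coefficients of \<open>g = f - h\<close> at \<open>\<Lambda>\<^sup>* + a\<close> says
  that the \<open>\<Lambda>\<close>-periodization of \<open>g e\<^sub>-\<^sub>a\<close> vanishes, i.e. the sum of \<open>g (x + \<lambda>) e\<^sub>-\<^sub>a(\<lambda>)\<close> over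
  \<open>\<lambda> \<in> S\<close> is zero for almost every such \<open>x\<close>. With \<open>a = \<delta> j + \<eta>\<close> this is a linear
  system for the values \<open>g (x + \<lambda>)\<close> whose matrix consists of the monomials with exponents
  \<open>j\<close> in the shift index set, evaluated at the nodes \<open>exp (-2 \<pi> i v\<^sub>l \<lambda>\<^sub>l / q\<^sub>l)\<close>. Weak admissibility
  makes the nodes distinct along every fiber of \<open>S\<close>, and the system is then regular by an iterated
  Vandermonde argument.

  That a periodization with vanishing Fourier coefficients is zero almost everywhere comes from the
  density of trigonometric polynomials: by Stone-Weierstrass the image of the measure \<open>u dx\<close> on the
  torus annihilates the continuous functions, hence the closed sets, hence all Borel sets.
\<close>

section \<open>Unisolvence of the shift index set\<close>

text \<open>Let \<open>p\<close> be the polynomial with roots \<open>w y\<close> for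
  \<open>y\<close> in \<open>Z - {z}\<close>. Its degree is below \<open>card Z\<close>, so the
  hypotheses combine to make the sum of \<open>c y * poly p (w y)\<close> vanish. Only the term at
  \<open>z\<close> survives, and injectivity keeps its factor \<open>poly p (w z)\<close>
  nonzero.\<close>

lemma vandermonde_eq_0:
  fixes w :: "'a \<Rightarrow> 'b::idom"
  assumes Z: "finite Z" and inj: "inj_on w Z"
    and 0: "\<And>t. t < card Z \<Longrightarrow> (\<Sum>z\<in>Z. c z * w z ^ t) = 0"
    and z: "z \<in> Z"
  shows "c z = 0"
proof -
  define p where "p = (\<Prod>y\<in>Z - {z}. [:- w y, 1:])"
  have "degree p = card (Z - {z})"
    unfolding p_def by (subst degree_prod_eq_sum_degree) auto
  then have deg: "degree p < card Z"
    using Z z by (metis card_Diff1_less)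
  have root: "poly p (w y) = 0" if "y \<in> Z - {z}" for y
    using that Z by (auto simp: p_def poly_prod)
  have nz: "poly p (w z) \<noteq> 0"
    using Z inj z by (auto simp: p_def poly_prod inj_on_def)
  have "(\<Sum>y\<in>Z. c y * poly p (w y)) = (\<Sum>y\<in>Z. \<Sum>t\<le>degree p. coeff p t * (c y * w y ^ t))"
    by (simp add: poly_altdef sum_distrib_left mult_ac)
  also have "\<dots> = (\<Sum>t\<le>degree p. coeff p t * (\<Sum>y\<in>Z. c y * w y ^ t))"
    by (subst sum.swap) (simp add: sum_distrib_left)
  also have "\<dots> = 0"
    using 0 deg by (intro sum.neutral) auto
  also have "(\<Sum>y\<in>Z. c y * poly p (w y)) = c z * poly p (w z)"
    using Z z root by (subst sum.remove[OF Z z]) simp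
  finally show ?thesis using nz by simp
qed

text \<open>The matrix entry of the linear system at the point \<open>m\<close> and the exponent
  vector \<open>j\<close>. Each coordinate has its own node function \<open>w i\<close>; powers are
  integer powers because shift indices are lists of integers.\<close>

definition list_monomial :: "(nat \<Rightarrow> real \<Rightarrow> complex) \<Rightarrow> real list \<Rightarrow> int list \<Rightarrow> complex" where
  "list_monomial w m j = (\<Prod>i<length m. w i (m ! i) powi (j ! i))"

lemma list_monomial_snoc:
  assumes "length j = length m"
  shows "list_monomial w (m @ [z]) (j @ [a]) = list_monomial w m j * w (length m) z powi a"
  using assms by (simp add: list_monomial_def nth_append)

text \<open>The enumeration disappears: for a fixed last entry \<open>t\<close>, the relevant tail
  consists of the base points whose fibers have more than \<open>t\<close> elements. The induction
  on the dimension runs on this form.\<close>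

lemma shift_index_Suc_Suc:
  assumes "finite S"
  shows "shift_index (Suc (Suc l)) S =
    {j @ [int t] | j t. (\<exists>m\<in>butlast ` S. t < card (fiber S m)) \<and>
       j \<in> shift_index (Suc l) {m \<in> butlast ` S. t < card (fiber S m)}}"
  using shift_index_union_eq[OF is_fiber_enum_fiber_enum[OF assms], of "shift_index (Suc l)"]
  by (simp add: Let_def)

lemma length_shift_index:
  "finite S \<Longrightarrow> j \<in> shift_index l S \<Longrightarrow> length j = l"
proof (induction l arbitrary: S j)
  case (Suc l)
  show ?case
  proof (cases l)
    case 0
    then show ?thesis using Suc.prems by auto
  next
    case (Suc k)
    then obtain i t where j: "j = i @ [int t]"
        "i \<in> shift_index l {m \<in> butlast ` S. t < card (fiber S m)}"
      using Suc.prems by (auto simp: shift_index_Suc_Suc simp del: shift_index.simps(3))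
    moreover have "length i = l"
      using Suc.prems(1) by (intro Suc.IH[OF _ j(2)]) simp
    ultimately show ?thesis by simp
  qed
qed simp

lemma finite_fiber:
  assumes "finite S"
  shows "finite (fiber S m)"
proof (rule finite_subset)
  show "fiber S m \<subseteq> last ` S"
    by (force simp: fiber_def image_iff)
qed (use assms in simp)

lemma sum_fibers:
  assumes S: "finite S" "[] \<notin> S"
  shows "(\<Sum>x\<in>S. F x) = (\<Sum>m\<in>butlast ` S. \<Sum>z\<in>fiber S m. F (m @ [z]))"
proof -
  have *: "{x \<in> S. butlast x = m} = (\<lambda>z. m @ [z]) ` fiber S m" for m
    using S(2) by (auto simp: fiber_def image_iff) (metis append_butlast_last_id)
  have "(\<Sum>x\<in>S. F x) = (\<Sum>m\<in>butlast ` S. \<Sum>x | x \<in> S \<and> butlast x = m. F x)"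
    using S by (simp add: sum.group)
  also have "\<dots> = (\<Sum>m\<in>butlast ` S. \<Sum>z\<in>fiber S m. F (m @ [z]))"
    unfolding * by (subst sum.reindex) (auto simp: inj_on_def)
  finally show ?thesis .
qed

text \<open>
  Peel off the last coordinate: the power sums of the coefficients along the fibers vanish, by
  strong induction on the exponent \<open>t\<close>. A fiber with at most \<open>t\<close> points has only zero coefficients,
  by Vandermonde, so only the fibers with more than \<open>t\<close> points remain, and the points under those
  fibers are the ones whose shift index set is attached to \<open>t\<close>.
\<close>

proposition shift_index_unisolvent:
  assumes "finite S" and "\<And>m. m \<in> S \<Longrightarrow> length m = Suc l"
    and "\<And>i m. i \<le> l \<Longrightarrow> m \<in> take i ` S \<Longrightarrow> inj_on (w i) (fiber (take (Suc i) ` S) m)"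
    and "\<And>j. j \<in> shift_index (Suc l) S \<Longrightarrow> (\<Sum>m\<in>S. c m * list_monomial w m j) = 0"
    and "m \<in> S"
  shows "c m = 0"
  using assms
proof (induction l arbitrary: S c m)
  case 0
  \<comment> \<open>In dimension one the whole set is the fiber over the empty list, and Vandermonde
    applies directly.\<close>
  have S: "S = (\<lambda>z. [z]) ` fiber S []"
  proof (intro equalityI subsetI)
    fix x assume x: "x \<in> S"
    then obtain z where "x = [z]"
      using "0.prems"(2) by (metis length_0_conv length_Suc_conv)
    with x show "x \<in> (\<lambda>z. [z]) ` fiber S []" by (simp add: fiber_def)
  qed (auto simp: fiber_def)
  have card: "card S = card (fiber S [])"
    by (subst S) (simp add: card_image inj_on_def)
  have t1: "take 1 ` S = S"
    using "0.prems"(2) by (force simp: image_iff)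
  have inj: "inj_on (w 0) (fiber S [])"
    using "0.prems"(3)[of 0 "[]"] \<open>m \<in> S\<close> t1 by (auto simp: image_iff)
  have "(\<Sum>z\<in>fiber S []. c [z] * w 0 z ^ t) = 0" if "t < card (fiber S [])" for t
  proof -
    have "(\<Sum>z\<in>fiber S []. c [z] * w 0 z ^ t) =
        (\<Sum>m\<in>(\<lambda>z. [z]) ` fiber S []. c m * list_monomial w m [int t])"
      by (subst sum.reindex) (auto simp: inj_on_def list_monomial_def)
    also have "\<dots> = 0"
      unfolding S[symmetric] using that card by (intro "0.prems"(4)) auto
    finally show ?thesis .
  qed
  moreover obtain z where "m = [z]" "z \<in> fiber S []"
    using \<open>m \<in> S\<close> S by auto
  ultimately show ?case
    using vandermonde_eq_0[OF finite_fiber[OF "0.prems"(1)] inj, of "\<lambda>z. c [z]"] by simp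
next
  case (Suc l)
  let ?S' = "butlast ` S" and ?b = "\<lambda>m t. \<Sum>z\<in>fiber S m. c (m @ [z]) * w (Suc l) z ^ t"
  note fin = Suc.prems(1) and len = Suc.prems(2)
  have "[] \<notin> S" using len by force
  have len': "length m = Suc l" if "m \<in> ?S'" for m
    using that len by auto
  have take_S: "take (Suc (Suc l)) ` S = S"
    using len by (force simp: image_iff)
  have but: "butlast x = take (Suc l) x" if "x \<in> S" for x
    using len[OF that] by (simp add: butlast_conv_take)
  then have take_S': "take (Suc l) ` S = ?S'"
    by (force simp: image_iff)
  have inj: "inj_on (w (Suc l)) (fiber S m)" if "m \<in> ?S'" for m
    using Suc.prems(3)[of "Suc l" m] that unfolding take_S take_S' by simp
  have vander: "c (m @ [z]) = 0"
    if m: "m \<in> ?S'" and z: "z \<in> fiber S m" and b: "\<And>t. t < card (fiber S m) \<Longrightarrow> ?b m t = 0" for m z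
    using vandermonde_eq_0[OF finite_fiber[OF fin] inj[OF m] b z] .
  have b0: "?b m t = 0" if "m \<in> ?S'" for m t
    using that
  proof (induction t arbitrary: m rule: less_induct)
    case (less t)
    let ?T = "{m \<in> ?S'. t < card (fiber S m)}"
    have outside: "?b m t = 0" if "m \<in> ?S' - ?T" for m
      using that vander[of m] less.IH by (intro sum.neutral) auto
    \<comment> \<open>Passing to \<open>?T\<close> can only shrink the projections and their fibers,
      so injectivity of the nodes is inherited.\<close>
    have sub: "take i ` ?T \<subseteq> take i ` S" if "i \<le> Suc l" for i
    proof -
      have "take i (butlast x) = take i x" if "x \<in> S" for x
        using \<open>i \<le> Suc l\<close> but[OF that] by (simp add: min_absorb1)
      then show ?thesis by (force simp: image_iff)
    qed
    \<comment> \<open>The outer induction hypothesis is applied to \<open>?T\<close>, with the power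
      sums of exponent \<open>t\<close> as the new coefficients.\<close>
    have "?b m t = 0" if m: "m \<in> ?T"
    proof (rule Suc.IH[of ?T "\<lambda>m. ?b m t"])
      fix i m assume i: "i \<le> l" and m: "m \<in> take i ` ?T"
      have "m \<in> take i ` S" using sub[of i] i m by auto
      then have "inj_on (w i) (fiber (take (Suc i) ` S) m)"
        using Suc.prems(3)[of i] i by simp
      then show "inj_on (w i) (fiber (take (Suc i) ` ?T) m)"
        by (rule inj_on_subset) (use sub[of "Suc i"] i in \<open>auto simp: fiber_def\<close>)
    next
      fix j assume j: "j \<in> shift_index (Suc l) ?T"
      then have lj: "length j = Suc l"
        using fin by (intro length_shift_index) auto
      have "j @ [int t] \<in> shift_index (Suc (Suc l)) S"
        using j m unfolding shift_index_Suc_Suc[OF fin] by blast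
      then have "0 = (\<Sum>x\<in>S. c x * list_monomial w x (j @ [int t]))"
        using Suc.prems(4) by simp
      also have "\<dots> = (\<Sum>m\<in>?S'. \<Sum>z\<in>fiber S m. c (m @ [z]) * list_monomial w (m @ [z]) (j @ [int t]))"
        using fin \<open>[] \<notin> S\<close> by (rule sum_fibers)
      also have "\<dots> = (\<Sum>m\<in>?S'. ?b m t * list_monomial w m j)"
        using lj len' by (intro sum.cong) (auto simp: list_monomial_snoc sum_distrib_left sum_distrib_right mult_ac)
      also have "\<dots> = (\<Sum>m\<in>?T. ?b m t * list_monomial w m j)"
        using fin outside by (intro sum.mono_neutral_right) auto
      finally show "(\<Sum>m\<in>?T. ?b m t * list_monomial w m j) = 0" by simp
    qed (use m fin len' in auto)
    then show ?case using outside less.prems by blast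
  qed
  have "m = butlast m @ [last m]"
    using \<open>m \<in> S\<close> \<open>[] \<notin> S\<close> by (metis append_butlast_last_id)
  then show ?case
    using vander[of "butlast m" "last m"] b0[of "butlast m"] \<open>m \<in> S\<close> by (auto simp: fiber_def)
qed

section \<open>Lattices and exponentials\<close>

lemma exponential_cis: "exponential l x = cis (2 * pi * (l \<bullet> x))"
  by (simp add: exponential_def cis_conv_exp mult_ac)

lemma exponential_add: "exponential (l + l') x = exponential l x * exponential l' x"
  by (simp add: exponential_cis cis_mult inner_add_left algebra_simps)

lemma exponential_add_right: "exponential l (x + y) = exponential l x * exponential l y"
  by (simp add: exponential_cis cis_mult inner_add_right algebra_simps)

lemma cnj_exponential: "cnj (exponential l x) = exponential (- l) x"
  by (simp add: exponential_cis cis_cnj)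

lemma norm_exponential [simp]: "norm (exponential l x) = 1"
  by (simp add: exponential_cis)

lemma continuous_on_exponential: "continuous_on A (exponential l)"
  unfolding exponential_def by (intro continuous_intros)

lemma borel_measurable_exponential [measurable]: "exponential l \<in> borel_measurable borel"
  by (intro borel_measurable_continuous_onI continuous_on_exponential)

lemma lattice_of_0: "0 \<in> lattice_of M"
  unfolding lattice_of_def by (intro image_eqI[of _ _ 0]) auto

lemma lattice_of_add:
  assumes "a \<in> lattice_of M" "b \<in> lattice_of M"
  shows "a + b \<in> lattice_of M"
proof -
  obtain z z' where "a = M *v z" "b = M *v z'" "\<forall>i. z $ i \<in> \<int>" "\<forall>i. z' $ i \<in> \<int>"
    using assms by (auto simp: lattice_of_def)
  then show ?thesis
    unfolding lattice_of_def by (intro image_eqI[of _ _ "z + z'"]) (auto simp: matrix_vector_right_distrib)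
qed

lemma lattice_of_minus:
  assumes "a \<in> lattice_of M"
  shows "- a \<in> lattice_of M"
proof -
  obtain z where "a = M *v z" "\<forall>i. z $ i \<in> \<int>"
    using assms by (auto simp: lattice_of_def)
  then show ?thesis
    unfolding lattice_of_def
    by (intro image_eqI[of _ _ "- z"]) (auto simp: matrix_vector_mult_diff_distrib[of M 0 z, simplified])
qed

lemma countable_lattice_of: "countable (lattice_of (M :: real ^ 'd ^ 'd))"
proof -
  let ?r = "\<lambda>j :: int ^ 'd. \<chi> i. real_of_int (j $ i)"
  have "{z :: real ^ 'd. \<forall>i. z $ i \<in> \<int>} \<subseteq> range ?r"
  proof
    fix z :: "real ^ 'd" assume "z \<in> {z. \<forall>i. z $ i \<in> \<int>}"
    then have "\<forall>i. \<exists>n. z $ i = real_of_int n" by (auto elim: Ints_cases)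
    then obtain n where "\<forall>i. z $ i = real_of_int (n i)" by metis
    then have "z = ?r (vec_lambda n)" by (simp add: vec_eq_iff)
    then show "z \<in> range ?r" by blast
  qed
  then have "countable {z :: real ^ 'd. \<forall>i. z $ i \<in> \<int>}"
    by (rule countable_subset) (rule countable_image, rule countableI_type)
  then show ?thesis unfolding lattice_of_def by (rule countable_image)
qed

text \<open>The columns of the generator matrix of the dual lattice. Pairing with them reads off
  coordinates with respect to \<open>M\<close>.\<close>

definition dual_basis :: "real ^ 'd ^ 'd \<Rightarrow> 'd \<Rightarrow> real ^ 'd" where
  "dual_basis M i = transpose (matrix_inv M) *v axis i 1"

lemma dual_basis_in: "dual_basis M i \<in> dual_lattice_of M"
  unfolding dual_basis_def dual_lattice_of_def lattice_of_def by (intro imageI) (simp add: axis_def)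

lemma inner_transpose: "(transpose N *v a) \<bullet> x = a \<bullet> (N *v x)" for N :: "real ^ 'd ^ 'd"
  by (metis dot_lmul_matrix transpose_matrix_vector)

lemma inner_dual_basis: "dual_basis M i \<bullet> x = (matrix_inv M *v x) $ i"
  unfolding dual_basis_def inner_transpose by (simp add: inner_axis')

lemma matrix_inv_vector:
  fixes M :: "real ^ 'd ^ 'd"
  assumes "invertible M"
  shows "matrix_inv M *v (M *v x) = x" "M *v (matrix_inv M *v x) = x"
proof -
  have "M ** matrix_inv M = mat 1 \<and> matrix_inv M ** M = mat 1"
    using assms unfolding invertible_def matrix_inv_def by (rule someI_ex)
  then show "matrix_inv M *v (M *v x) = x" "M *v (matrix_inv M *v x) = x"
    by (simp_all add: matrix_vector_mul_assoc)
qed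

lemma inner_dual_lattice:
  assumes "invertible M" "\<mu> \<in> dual_lattice_of M" "l \<in> lattice_of M"
  shows "\<mu> \<bullet> l \<in> \<int>"
proof -
  obtain a where a: "\<mu> = transpose (matrix_inv M) *v a" "\<forall>i. a $ i \<in> \<int>"
    using assms(2) unfolding dual_lattice_of_def lattice_of_def by blast
  obtain b where b: "l = M *v b" "\<forall>i. b $ i \<in> \<int>"
    using assms(3) unfolding lattice_of_def by blast
  have "\<mu> \<bullet> l = (\<Sum>i\<in>UNIV. a $ i * b $ i)"
    unfolding a(1) b(1) inner_transpose matrix_inv_vector(1)[OF assms(1)] by (simp add: inner_vec_def)
  also have "\<dots> \<in> \<int>"
    using a(2) b(2) by (intro Ints_sum Ints_mult) blast+
  finally show ?thesis .
qed

section \<open>Reduction modulo the lattice and the torus\<close>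

definition reduce :: "real ^ 'd ^ 'd \<Rightarrow> real ^ 'd \<Rightarrow> real ^ 'd" where
  "reduce M x = M *v (\<chi> i. frac ((matrix_inv M *v x) $ i))"

lemma reduce_diff:
  assumes "invertible M"
  shows "x - reduce M x \<in> lattice_of M"
proof -
  have "x - reduce M x = M *v (\<chi> i. of_int \<lfloor>(matrix_inv M *v x) $ i\<rfloor>)"
  proof -
    have "(\<chi> i. of_int \<lfloor>(matrix_inv M *v x) $ i\<rfloor>) = matrix_inv M *v x - (\<chi> i. frac ((matrix_inv M *v x) $ i))"
      by (simp add: vec_eq_iff frac_def)
    then show ?thesis
      by (simp add: reduce_def matrix_vector_mult_diff_distrib matrix_inv_vector[OF assms])
  qed
  then show ?thesis unfolding lattice_of_def by auto
qed

lemma reduce_eq: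
  assumes "invertible M" "y \<in> fund_domain M" "x - y \<in> lattice_of M"
  shows "reduce M x = y"
proof -
  obtain t where t: "y = M *v t" "\<And>i. 0 \<le> t $ i \<and> t $ i < 1"
    using assms(2) by (auto simp: fund_domain_def)
  obtain z where z: "x - y = M *v z" "\<And>i. z $ i \<in> \<int>"
    using assms(3) by (auto simp: lattice_of_def)
  have "x = M *v (z + t)"
    using t(1) z(1) by (simp add: matrix_vector_right_distrib algebra_simps)
  then have "matrix_inv M *v x = z + t"
    by (simp add: matrix_inv_vector[OF assms(1)])
  moreover have "frac (z $ i + t $ i) = t $ i" for i
    using t(2)[of i] z(2)[of i] by (auto simp: frac_unique_iff)
  ultimately show ?thesis
    unfolding reduce_def t(1) by (simp add: vec_lambda_eta)
qed

text \<open>For invertible \<open>M\<close> this is the quotient map modulo the lattice, with the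
  torus embedded in complex space. The image lies in a compact ball, which is what Stone-Weierstrass
  needs.\<close>

definition torus_map :: "real ^ 'd ^ 'd \<Rightarrow> real ^ 'd \<Rightarrow> complex ^ 'd" where
  "torus_map M x = (\<chi> i. exponential (dual_basis M i) x)"

lemma continuous_on_torus_map: "continuous_on A (torus_map M)"
  unfolding torus_map_def by (intro continuous_intros continuous_on_exponential)

lemma borel_measurable_torus_map [measurable]: "torus_map M \<in> borel_measurable borel"
  by (intro borel_measurable_continuous_onI continuous_on_torus_map)

lemma torus_map_bound: "torus_map (M :: real ^ 'd ^ 'd) x \<in> cball 0 (real CARD('d))"
proof -
  have "norm (torus_map M x) \<le> (\<Sum>i\<in>UNIV. norm (torus_map M x $ i))"
    unfolding norm_vec_def by (rule L2_set_le_sum) simp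
  then show ?thesis by (simp add: torus_map_def)
qed

text \<open>The argument jumps at the positive real axis, but its strict superlevel sets are
  open.\<close>

lemma borel_measurable_Arg2pi [measurable]: "Arg2pi \<in> borel_measurable borel"
  by (subst borel_measurable_iff_greater) (use open_Arg2pi2pi_gt in auto)

text \<open>A Borel way back from the torus to the fundamental domain: \<open>Arg2pi\<close> has
  values in [0, 2 pi), so dividing by 2 pi recovers the fractional parts. Borel sets of reduced
  points thereby become Borel sets on the torus.\<close>

definition untorus :: "real ^ 'd ^ 'd \<Rightarrow> complex ^ 'd \<Rightarrow> real ^ 'd" where
  "untorus M z = M *v (\<chi> i. Arg2pi (z $ i) / (2 * pi))"

lemma borel_measurable_untorus [measurable]: "untorus M \<in> borel_measurable borel"
proof -
  have 1: "(\<lambda>z :: complex ^ 'd. \<chi> i. Arg2pi (z $ i) / (2 * pi)) \<in> borel_measurable borel"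
  proof (subst borel_measurable_euclidean_space, intro ballI)
    fix b :: "real ^ 'd" assume "b \<in> Basis"
    then obtain i where b: "b = axis i 1" by (auto simp: Basis_vec_def)
    have [measurable]: "(\<lambda>z :: complex ^ 'd. z $ i) \<in> borel_measurable borel"
      by (intro borel_measurable_continuous_onI continuous_intros)
    show "(\<lambda>z :: complex ^ 'd. (\<chi> i. Arg2pi (z $ i) / (2 * pi)) \<bullet> b) \<in> borel_measurable borel"
      unfolding b by (simp add: inner_axis)
  qed
  have 2: "(*v) M \<in> borel_measurable borel"
    by (intro borel_measurable_continuous_onI matrix_vector_mult_linear_continuous_on)
  show ?thesis
    using measurable_comp[OF 1 2] by (simp add: comp_def untorus_def[abs_def])
qed

lemma untorus_torus_map: "untorus M (torus_map M x) = reduce M x"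
proof -
  have "Arg2pi (cis (2 * pi * r)) / (2 * pi) = frac r" for r
  proof -
    have "cis (2 * pi * r) = cis (2 * pi * frac r)"
      unfolding cis_eq_iff rcong_altdef
      by (rule exI[of _ "- \<lfloor>r\<rfloor>"]) (simp add: frac_def algebra_simps)
    moreover have "Arg2pi (cis (2 * pi * frac r)) = 2 * pi * frac r"
      by (rule Arg2pi_unique[of 1]) (auto simp: cis_conv_exp frac_lt_1)
    ultimately show ?thesis by simp
  qed
  then show ?thesis
    by (simp add: untorus_def torus_map_def reduce_def exponential_cis inner_dual_basis)
qed

section \<open>Functions with vanishing Fourier coefficients\<close>

text \<open>Trigonometric polynomials with frequencies in the dual lattice. Only linear operations
  generate them, so vanishing of integrals passes to them by induction; closure under products is
  derived from the group law of the frequencies.\<close>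

inductive_set trig :: "real ^ 'd ^ 'd \<Rightarrow> (real ^ 'd \<Rightarrow> complex) set" for M where
  exponential: "\<mu> \<in> dual_lattice_of M \<Longrightarrow> exponential \<mu> \<in> trig M"
| scale: "F \<in> trig M \<Longrightarrow> (\<lambda>x. a * F x) \<in> trig M"
| add: "F \<in> trig M \<Longrightarrow> G \<in> trig M \<Longrightarrow> (\<lambda>x. F x + G x) \<in> trig M"

lemma trig_const: "(\<lambda>x. a) \<in> trig M"
proof -
  have "(\<lambda>x. a * exponential 0 x) \<in> trig M"
    by (intro trig.intros) (simp add: dual_lattice_of_def lattice_of_0)
  then show ?thesis by (simp add: exponential_def)
qed

lemma trig_sum: "(\<And>i. i \<in> I \<Longrightarrow> F i \<in> trig M) \<Longrightarrow> (\<lambda>x. \<Sum>i\<in>I. F i x) \<in> trig M"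
  by (induction I rule: infinite_finite_induct) (auto intro: trig_const trig.add)

lemma trig_mult_exponential:
  assumes \<mu>: "\<mu> \<in> dual_lattice_of M"
  shows "G \<in> trig M \<Longrightarrow> (\<lambda>x. exponential \<mu> x * G x) \<in> trig M"
proof (induction rule: trig.induct)
  case (exponential \<nu>)
  then show ?case
    using trig.exponential[of "\<mu> + \<nu>" M] \<mu>
    by (auto simp: dual_lattice_of_def exponential_add[abs_def] lattice_of_add)
next
  case (scale F a)
  then show ?case using trig.scale[of "\<lambda>x. exponential \<mu> x * F x" M a] by (simp add: mult_ac)
next
  case (add F G)
  then show ?case using trig.add[OF add.IH] by (simp add: distrib_left)
qed

lemma trig_mult: "F \<in> trig M \<Longrightarrow> G \<in> trig M \<Longrightarrow> (\<lambda>x. F x * G x) \<in> trig M"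
proof (induction rule: trig.induct)
  case (exponential \<nu>)
  then show ?case by (rule trig_mult_exponential)
next
  case (scale F a)
  then show ?case using trig.scale[of "\<lambda>x. F x * G x" M a] by (simp add: mult_ac)
next
  case (add F1 F2)
  then show ?case using trig.add[of "\<lambda>x. F1 x * G x" M "\<lambda>x. F2 x * G x"] by (simp add: distrib_right)
qed

text \<open>Real and imaginary parts of a torus coordinate are combinations of the exponentials at a
  dual basis vector and its negative. This settles real linear forms; products are covered by
  \<open>trig_mult\<close>.\<close>

lemma trig_real_polynomial:
  assumes "real_polynomial_function p"
  shows "(\<lambda>x. complex_of_real (p (torus_map M x))) \<in> trig M"
  using assms
proof (induction rule: real_polynomial_function.induct)
  case (linear p)
  interpret bounded_linear p by fact
  \<comment> \<open>Expansion in the real basis \<open>axis i 1\<close>, \<open>axis i \<i>\<close>,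
    since \<open>p\<close> is only real-linear.\<close>
  have p: "p z = (\<Sum>i\<in>UNIV. Re (z $ i) * p (axis i 1) + Im (z $ i) * p (axis i \<i>))" for z
  proof -
    have "z = (\<Sum>i\<in>UNIV. Re (z $ i) *\<^sub>R axis i 1 + Im (z $ i) *\<^sub>R axis i \<i>)"
      by (simp add: vec_eq_iff axis_def if_distrib complex_eq_iff cong: if_cong)
    then have "p z = p (\<Sum>i\<in>UNIV. Re (z $ i) *\<^sub>R axis i 1 + Im (z $ i) *\<^sub>R axis i \<i>)" by simp
    then show ?thesis by (simp add: sum add scaleR)
  qed
  have e: "exponential (dual_basis M i) \<in> trig M" "exponential (- dual_basis M i) \<in> trig M" for i
    using dual_basis_in[of M i] by (auto intro!: trig.exponential simp: dual_lattice_of_def lattice_of_minus)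
  have Re: "complex_of_real (Re z) = 1/2 * z + 1/2 * cnj z" for z
    by (simp add: complex_eq_iff)
  have Im: "complex_of_real (Im z) = - \<i>/2 * z + \<i>/2 * cnj z" for z
    by (simp add: complex_eq_iff)
  have "(\<lambda>x. \<Sum>i\<in>UNIV. complex_of_real (p (axis i 1)) * (1/2 * exponential (dual_basis M i) x + 1/2 * exponential (- dual_basis M i) x)
      + complex_of_real (p (axis i \<i>)) * (- \<i>/2 * exponential (dual_basis M i) x + \<i>/2 * exponential (- dual_basis M i) x)) \<in> trig M"
    by (intro trig_sum trig.add trig.scale e)
  then show ?case
    by (subst p) (simp add: torus_map_def Re Im cnj_exponential mult.commute)
next
  case (mult f g)
  then show ?case using trig_mult[OF mult.IH] by simp
next
  case (add f g)
  then show ?case using trig.add[OF add.IH] by simp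
qed (auto intro: trig_const)

lemma integrable_mult_bounded_complex:
  fixes u G :: "'a \<Rightarrow> complex"
  assumes "integrable N u" and "G \<in> borel_measurable N" and "\<And>x. norm (G x) \<le> B"
  shows "integrable N (\<lambda>x. u x * G x)"
proof (rule Bochner_Integration.integrable_bound)
  show "integrable N (\<lambda>x. B * norm (u x))" using assms(1) by simp
  show "AE x in N. norm (u x * G x) \<le> norm (B * norm (u x))"
  proof (intro AE_I2)
    fix x
    have "0 \<le> B" using assms(3)[of x] norm_ge_zero order_trans by blast
    then show "norm (u x * G x) \<le> norm (B * norm (u x))"
      using assms(3)[of x] by (simp add: norm_mult mult.commute[of "cmod (u x)"] mult_right_mono)
  qed
qed (use assms in auto)

lemma integral_trig_eq_0:
  assumes u: "integrable lebesgue u"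
    and 0: "\<And>\<mu>. \<mu> \<in> dual_lattice_of M \<Longrightarrow> (\<integral>x. u x * exponential \<mu> x \<partial>lebesgue) = 0"
  shows "F \<in> trig M \<Longrightarrow> integrable lebesgue (\<lambda>x. u x * F x) \<and> (\<integral>x. u x * F x \<partial>lebesgue) = 0"
proof (induction rule: trig.induct)
  case (exponential \<mu>)
  have "integrable lebesgue (\<lambda>x. u x * exponential \<mu> x)"
    by (rule integrable_mult_bounded_complex[OF u, of _ 1])
      (auto intro: measurable_completion)
  with 0 exponential show ?case by blast
next
  case (scale F a)
  then show ?case by (simp add: mult.left_commute[of _ a])
next
  case (add F G)
  then show ?case by (simp add: distrib_left)
qed

text \<open>A polynomial approximates \<open>\<phi>\<close> within \<open>e\<close> on a ball
  containing the torus. Its composition with \<open>torus_map\<close> integrates to zero against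
  \<open>u\<close>, so what remains is at most \<open>e\<close> times the L1 norm of
  \<open>u\<close>.\<close>

lemma integral_continuous_torus_eq_0:
  fixes M :: "real ^ 'd ^ 'd"
  assumes u: "integrable lebesgue u"
    and 0: "\<And>\<mu>. \<mu> \<in> dual_lattice_of M \<Longrightarrow> (\<integral>x. u x * exponential \<mu> x \<partial>lebesgue) = 0"
    and \<phi>: "continuous_on UNIV (\<phi> :: complex ^ 'd \<Rightarrow> real)"
  shows "(\<integral>x. u x * complex_of_real (\<phi> (torus_map M x)) \<partial>lebesgue) = 0" (is "?I = 0")
proof -
  let ?K = "cball 0 (real CARD('d)) :: (complex ^ 'd) set"
  let ?c = "\<integral>x. norm (u x) \<partial>lebesgue"
  have meas: "(\<lambda>x. complex_of_real (\<psi> (torus_map M x))) \<in> borel_measurable lebesgue"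
    if "continuous_on UNIV \<psi>" for \<psi> :: "complex ^ 'd \<Rightarrow> real"
  proof -
    have [measurable]: "\<psi> \<in> borel_measurable borel"
      using that by (rule borel_measurable_continuous_onI)
    show ?thesis by (intro measurable_completion) simp
  qed
  have bound: "norm ?I \<le> e * ?c" if e: "e > 0" for e
  proof -
    obtain p where p: "real_polynomial_function p" "\<And>z. z \<in> ?K \<Longrightarrow> \<bar>\<phi> z - p z\<bar> < e"
      using Stone_Weierstrass_real_polynomial_function[of ?K \<phi> e] \<phi> e
      by (metis compact_cball continuous_on_subset top_greatest)
    have cp: "continuous_on UNIV p"
      using p(1) by (simp add: continuous_on_polymonial_function real_polynomial_function_eq)
    have P: "integrable lebesgue (\<lambda>x. u x * complex_of_real (p (torus_map M x)))"
      "(\<integral>x. u x * complex_of_real (p (torus_map M x)) \<partial>lebesgue) = 0"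
      using integral_trig_eq_0[OF u 0 trig_real_polynomial[OF p(1)]] by auto
    have D: "integrable lebesgue (\<lambda>x. u x * complex_of_real (\<phi> (torus_map M x) - p (torus_map M x)))"
    proof (rule integrable_mult_bounded_complex[OF u, of _ e])
      show "norm (complex_of_real (\<phi> (torus_map M x) - p (torus_map M x))) \<le> e" for x
        using p(2)[OF torus_map_bound[of M x]] unfolding norm_of_real by linarith
      show "(\<lambda>x. complex_of_real (\<phi> (torus_map M x) - p (torus_map M x))) \<in> borel_measurable lebesgue"
        using meas[of "\<lambda>z. \<phi> z - p z"] \<phi> cp by (simp add: continuous_on_diff)
    qed
    have "?I = (\<integral>x. u x * complex_of_real (\<phi> (torus_map M x) - p (torus_map M x))
        + u x * complex_of_real (p (torus_map M x)) \<partial>lebesgue)"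
      by (intro Bochner_Integration.integral_cong) (auto simp: algebra_simps)
    also have "\<dots> = (\<integral>x. u x * complex_of_real (\<phi> (torus_map M x) - p (torus_map M x)) \<partial>lebesgue)"
      using D P by (subst Bochner_Integration.integral_add) auto
    also have "norm \<dots> \<le> (\<integral>x. norm (u x * complex_of_real (\<phi> (torus_map M x) - p (torus_map M x))) \<partial>lebesgue)"
      by (rule integral_norm_bound)
    also have "\<dots> \<le> (\<integral>x. e * norm (u x) \<partial>lebesgue)"
    proof (rule integral_mono)
      show "norm (u x * complex_of_real (\<phi> (torus_map M x) - p (torus_map M x))) \<le> e * norm (u x)" for x
        using p(2)[OF torus_map_bound[of M x]]
        unfolding norm_mult norm_of_real mult.commute[of "norm (u x)"]
        by (intro mult_right_mono) auto
    qed (use u D in simp_all)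
    finally show ?thesis by simp
  qed
  have "norm ?I \<le> 0"
  proof (rule field_le_epsilon)
    fix e :: real assume "0 < e"
    \<comment> \<open>The bound is taken at \<open>e / (1 + ?c)\<close> rather than
      \<open>e / ?c\<close>, because \<open>?c\<close> may be zero.\<close>
    have "d / (1 + d) * e \<le> e" if "d \<ge> 0" for d :: real
      using that \<open>0 < e\<close> by (simp add: field_simps)
    moreover have "?c \<ge> 0" by simp
    moreover from this have "norm ?I \<le> e / (1 + ?c) * ?c"
      using \<open>0 < e\<close> by (intro bound divide_pos_pos) linarith+
    ultimately show "norm ?I \<le> 0 + e" by (smt (verit) mult.commute times_divide_eq_left)
  qed
  then show ?thesis by simp
qed

lemma integral_closed_torus_eq_0:
  fixes M :: "real ^ 'd ^ 'd"
  assumes u: "integrable lebesgue u"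
    and 0: "\<And>\<mu>. \<mu> \<in> dual_lattice_of M \<Longrightarrow> (\<integral>x. u x * exponential \<mu> x \<partial>lebesgue) = 0"
    and C: "closed (C :: (complex ^ 'd) set)"
  shows "(\<integral>x. u x * indicator C (torus_map M x) \<partial>lebesgue) = 0"
\<comment> \<open>The empty set is separate: \<open>infdist\<close> to it is 0 by convention, so the
  functions below would be constantly 1.\<close>
proof (cases "C = {}")
  case False
  \<comment> \<open>Continuous functions decreasing to the indicator of \<open>C\<close>; closedness
    gives convergence to 0 off \<open>C\<close>, and \<open>norm (u x)\<close> dominates.\<close>
  define \<phi> where "\<phi> n z = max 0 (1 - real n * infdist z C)" for n and z :: "complex ^ 'd"
  have cont: "continuous_on UNIV (\<phi> n)" for n
    unfolding \<phi>_def[abs_def] by (intro continuous_intros)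
  have [measurable]: "\<phi> n \<in> borel_measurable borel" for n
    using cont by (rule borel_measurable_continuous_onI)
  have [measurable]: "C \<in> sets borel" using C by simp
  have lim: "(\<lambda>n. \<phi> n z) \<longlonglongrightarrow> indicat_real C z" for z
  proof (cases "z \<in> C")
    case True
    then show ?thesis by (simp add: \<phi>_def)
  next
    case out: False
    then have d: "infdist z C > 0"
      using C False in_closed_iff_infdist_zero infdist_nonneg by (metis less_eq_real_def)
    obtain N where N: "1 / infdist z C < real N" using reals_Archimedean2 by blast
    have "\<phi> n z = 0" if "n \<ge> N" for n
    proof -
      have "1 / infdist z C \<le> real n" using N that by linarith
      then show ?thesis using d by (simp add: \<phi>_def field_simps max_def)
    qed
    then have "\<forall>\<^sub>F n in sequentially. \<phi> n z = indicat_real C z"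
      using out by (auto simp: eventually_sequentially)
    then show ?thesis by (rule tendsto_eventually)
  qed
  have 1: "\<bar>\<phi> n z\<bar> \<le> 1" for n z
    by (simp add: \<phi>_def infdist_nonneg)
  have [measurable]: "u \<in> borel_measurable lebesgue" using u by simp
  have [measurable]: "torus_map M \<in> borel_measurable lebesgue"
    by (intro measurable_completion) simp
  have "(\<lambda>n. \<integral>x. u x * complex_of_real (\<phi> n (torus_map M x)) \<partial>lebesgue) \<longlonglongrightarrow>
      (\<integral>x. u x * indicator C (torus_map M x) \<partial>lebesgue)"
  proof (rule integral_dominated_convergence)
    show "integrable lebesgue (\<lambda>x. norm (u x))" using u by simp
    show "AE x in lebesgue. (\<lambda>n. u x * complex_of_real (\<phi> n (torus_map M x)))
        \<longlonglongrightarrow> u x * indicator C (torus_map M x)"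
    proof (intro AE_I2 tendsto_mult tendsto_const)
      show "(\<lambda>n. complex_of_real (\<phi> n (torus_map M x))) \<longlonglongrightarrow> indicator C (torus_map M x)" for x
        using tendsto_of_real[OF lim[of "torus_map M x"], where ?'a = complex]
        by (cases "torus_map M x \<in> C") simp_all
    qed
    show "AE x in lebesgue. norm (u x * complex_of_real (\<phi> n (torus_map M x))) \<le> norm (u x)" for n
      using 1 by (intro AE_I2) (simp add: norm_mult mult_left_le)
  qed measurable
  moreover have "(\<integral>x. u x * complex_of_real (\<phi> n (torus_map M x)) \<partial>lebesgue) = 0" for n
    using integral_continuous_torus_eq_0[OF u 0 cont] .
  ultimately show ?thesis by (simp add: LIMSEQ_const_iff)
qed simp

text \<open>Dynkin's argument: closed sets are stable under intersection and generate the Borel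
  sets, and the vanishing of the integral passes to complements and countable disjoint
  unions.\<close>

proposition integral_borel_torus_eq_0:
  fixes M :: "real ^ 'd ^ 'd"
  assumes u: "integrable lebesgue u"
    and 0: "\<And>\<mu>. \<mu> \<in> dual_lattice_of M \<Longrightarrow> (\<integral>x. u x * exponential \<mu> x \<partial>lebesgue) = 0"
    and B: "B \<in> sets (borel :: (complex ^ 'd) measure)"
  shows "(\<integral>x. u x * indicator B (torus_map M x) \<partial>lebesgue) = 0"
proof -
  have int: "integrable lebesgue (\<lambda>x. u x * indicator B (torus_map M x))"
    if [measurable]: "B \<in> sets borel" for B
    by (rule integrable_mult_bounded_complex[OF u, of _ 1])
      (auto intro!: measurable_completion simp: indicator_def[of _ "torus_map M _"])
  have sets: "sets borel = sigma_sets UNIV (Collect (closed :: (complex ^ 'd) set \<Rightarrow> bool))"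
    unfolding borel_eq_closed by simp
  have "Int_stable (Collect (closed :: (complex ^ 'd) set \<Rightarrow> bool))"
    by (auto simp: Int_stable_def)
  moreover have "Collect (closed :: (complex ^ 'd) set \<Rightarrow> bool) \<subseteq> Pow UNIV" by simp
  ultimately show ?thesis using B[unfolded sets]
  proof (induction B rule: sigma_sets_induct_disjoint)
    case (basic C)
    then show ?case using integral_closed_torus_eq_0[OF u 0] by simp
  next
    case (compl A)
    have "(\<integral>x. u x * indicator (UNIV - A) (torus_map M x) \<partial>lebesgue) =
        (\<integral>x. u x * indicator UNIV (torus_map M x) - u x * indicator A (torus_map M x) \<partial>lebesgue)"
      by (intro Bochner_Integration.integral_cong) (auto simp: indicator_def)
    also have "\<dots> = (\<integral>x. u x * indicator UNIV (torus_map M x) \<partial>lebesgue)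
        - (\<integral>x. u x * indicator A (torus_map M x) \<partial>lebesgue)"
      using compl by (intro Bochner_Integration.integral_diff int) (auto simp: sets)
    also have "\<dots> = 0"
      using compl.IH integral_closed_torus_eq_0[OF u 0, where C = UNIV] by simp
    finally show ?case .
  next
    case (union A)
    have A: "A i \<in> sets borel" for i using union(2) sets by blast
    have "(\<lambda>n. \<integral>x. (\<Sum>i<n. u x * indicator (A i) (torus_map M x)) \<partial>lebesgue) \<longlonglongrightarrow>
        (\<integral>x. u x * indicator (\<Union>i. A i) (torus_map M x) \<partial>lebesgue)"
    proof (rule integral_dominated_convergence)
      show "integrable lebesgue (\<lambda>x. norm (u x))" using u by simp
      \<comment> \<open>Disjointness turns the partial sum of indicators into a single indicator, so
        \<open>norm (u x)\<close> dominates all partial sums.\<close>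
      have ind: "(\<Sum>i<n. u x * indicator (A i) (torus_map M x)) = u x * indicator (\<Union>i<n. A i) (torus_map M x)" for n x
        unfolding indicator_UN_disjoint[OF finite_lessThan disjoint_family_on_mono[OF subset_UNIV union(1)]]
        by (simp only: sum_distrib_left)
      show "AE x in lebesgue. norm (\<Sum>i<n. u x * indicator (A i) (torus_map M x)) \<le> norm (u x)" for n
        unfolding ind by (intro AE_I2) (simp add: norm_mult indicator_def)
      show "AE x in lebesgue. (\<lambda>n. \<Sum>i<n. u x * indicator (A i) (torus_map M x))
          \<longlonglongrightarrow> u x * indicator (\<Union>i. A i) (torus_map M x)"
        unfolding ind by (intro AE_I2 tendsto_mult tendsto_const LIMSEQ_indicator_UN)
      show "(\<lambda>x. u x * indicator (\<Union>i. A i) (torus_map M x)) \<in> borel_measurable lebesgue"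
        using A by (intro borel_measurable_integrable int) auto
      show "(\<lambda>x. \<Sum>i<n. u x * indicator (A i) (torus_map M x)) \<in> borel_measurable lebesgue" for n
        using A by (intro borel_measurable_sum borel_measurable_integrable int)
    qed
    moreover have "(\<integral>x. (\<Sum>i<n. u x * indicator (A i) (torus_map M x)) \<partial>lebesgue) = 0" for n
      by (subst Bochner_Integration.integral_sum) (use int A union in auto)
    ultimately show ?case by (simp add: LIMSEQ_const_iff)
  qed simp
qed

corollary integral_reduce_eq_0:
  fixes M :: "real ^ 'd ^ 'd"
  assumes "integrable lebesgue u"
    and "\<And>\<mu>. \<mu> \<in> dual_lattice_of M \<Longrightarrow> (\<integral>x. u x * exponential \<mu> x \<partial>lebesgue) = 0"
    and [measurable]: "B \<in> sets borel"
  shows "(\<integral>x. u x * indicator B (reduce M x) \<partial>lebesgue) = 0"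
proof -
  have [measurable]: "untorus M -` B \<in> sets borel"
    using measurable_sets[OF borel_measurable_untorus assms(3), of M] by simp
  have "(\<integral>x. u x * indicator (untorus M -` B) (torus_map M x) \<partial>lebesgue) = 0"
    by (rule integral_borel_torus_eq_0) (use assms in auto)
  then show ?thesis by (simp add: indicator_def untorus_torus_map)
qed


section \<open>Translations and periodization\<close>

lemma distr_lebesgue_plus: "distr lebesgue lebesgue (\<lambda>x :: 'a :: euclidean_space. x + a) = lebesgue"
  using lebesgue_affine_euclidean[of "\<lambda>_. 1" a]
  by (simp add: euclidean_representation density_1 add.commute)

lemma measurable_lebesgue_plus [measurable]:
  "(\<lambda>x :: 'a :: euclidean_space. x + a) \<in> lebesgue \<rightarrow>\<^sub>M lebesgue"
  using lebesgue_affine_measurable[of "\<lambda>_. 1" a]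
  by (simp add: euclidean_representation add.commute)

lemma integral_lebesgue_plus:
  fixes g :: "'a :: euclidean_space \<Rightarrow> complex"
  assumes "g \<in> borel_measurable lebesgue"
  shows "(\<integral>x. g (x + a) \<partial>lebesgue) = (\<integral>x. g x \<partial>lebesgue)"
  using integral_distr[OF measurable_lebesgue_plus assms, of a] by (simp add: distr_lebesgue_plus)

lemma integrable_lebesgue_plus:
  fixes g :: "'a :: euclidean_space \<Rightarrow> complex"
  assumes "integrable lebesgue g"
  shows "integrable lebesgue (\<lambda>x. g (x + a))"
  using assms integrable_distr[OF measurable_lebesgue_plus, of a g] by (simp add: distr_lebesgue_plus)

lemma AE_lebesgue_plus:
  assumes "AE x in lebesgue. P x"
  shows "AE x in lebesgue. P (x + a :: 'a :: euclidean_space)"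
proof -
  have "AE x in distr lebesgue lebesgue (\<lambda>x. x + a). P x"
    using assms by (subst distr_lebesgue_plus)
  then show ?thesis by (rule AE_distrD[OF measurable_lebesgue_plus])
qed

lemma sigma_finite_lebesgue: "sigma_finite_measure (lebesgue :: 'a :: euclidean_space measure)"
proof
  obtain A :: "'a set set" where "countable A" "A \<subseteq> sets lborel" "\<Union>A = space lborel"
      "\<forall>a\<in>A. emeasure lborel a \<noteq> \<infinity>"
    using lborel.sigma_finite_countable by blast
  then show "\<exists>A. countable A \<and> A \<subseteq> sets lebesgue \<and> \<Union>A = space lebesgue \<and>
      (\<forall>a\<in>A. emeasure (lebesgue :: 'a measure) a \<noteq> \<infinity>)"
    by (intro exI[of _ A]) (auto simp: emeasure_completion subset_iff)
qed

text \<open>On \<open>B\<close> the finite sum is the full periodization, by the support hypothesis.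
  Its integral over a Borel set \<open>D\<close> inside \<open>B\<close> unfolds to the integral of
  \<open>u\<close> over the points whose reduction lies in \<open>D\<close>, which is zero; since
  \<open>D\<close> is arbitrary, the sum vanishes almost everywhere on \<open>B\<close>.\<close>

proposition periodization_eq_0:
  fixes M :: "real ^ 'd ^ 'd" and u :: "real ^ 'd \<Rightarrow> complex"
  assumes u: "integrable lebesgue u"
    and 0: "\<And>\<mu>. \<mu> \<in> dual_lattice_of M \<Longrightarrow> (\<integral>x. u x * exponential \<mu> x \<partial>lebesgue) = 0"
    and M: "invertible M"
    and S: "finite S" "S \<subseteq> lattice_of M"
    and B: "B \<in> sets lebesgue" "B \<subseteq> fund_domain M"
    and supp: "\<And>x l. x \<in> B \<Longrightarrow> l \<in> lattice_of M - S \<Longrightarrow> u (x + l) = 0"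
  shows "AE x\<in>B in lebesgue. (\<Sum>l\<in>S. u (x + l)) = 0"
proof -
  let ?F = "\<lambda>x. \<Sum>l\<in>S. u (x + l)"
  have F: "integrable lebesgue ?F"
    by (intro Bochner_Integration.integrable_sum integrable_lebesgue_plus u)
  have [measurable]: "?F \<in> borel_measurable lebesgue" using F by simp
  have [measurable]: "u \<in> borel_measurable lebesgue" using u by simp
  have borel: "(\<integral>x. indicator D x *\<^sub>R ?F x \<partial>lebesgue) = 0" if D: "D \<in> sets borel" "D \<subseteq> B" for D
  proof -
    have [measurable]: "D \<in> sets lebesgue" using D by auto
    have red: "reduce M y = y - l" if "y - l \<in> D" "l \<in> S" for y l
    proof (rule reduce_eq[OF M])
      show "y - l \<in> fund_domain M" using that(1) D(2) B(2) by blast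
      show "y - (y - l) \<in> lattice_of M" using subsetD[OF S(2) that(2)] by simp
    qed
    \<comment> \<open>As \<open>D\<close> lies in the fundamental domain, at most one term is
      nonzero. If \<open>y\<close> reduces into \<open>D\<close> by a lattice vector outside
      \<open>S\<close>, then \<open>supp\<close> gives \<open>u y = 0\<close>.\<close>
    have point: "(\<Sum>l\<in>S. u y * indicator D (y - l)) = u y * indicator D (reduce M y)" for y
    proof (cases "reduce M y \<in> D \<and> y - reduce M y \<in> S")
      case True
      have iff: "y - l \<in> D \<longleftrightarrow> l = y - reduce M y" if "l \<in> S" for l
      proof
        assume *: "y - l \<in> D"
        show "l = y - reduce M y" unfolding red[OF * that] by simp
      next
        assume "l = y - reduce M y"
        then have "y - l = reduce M y" by simp
        then show "y - l \<in> D" using True by metis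
      qed
      have "(\<Sum>l\<in>S. u y * indicator D (y - l)) = (\<Sum>l\<in>S. if l = y - reduce M y then u y else 0)"
        using iff by (intro sum.cong) (simp_all add: indicator_def)
      then show ?thesis using S(1) True by simp
    next
      case False
      have "u y * indicator D (reduce M y) = 0"
        using False supp[of "reduce M y" "y - reduce M y"] reduce_diff[OF M, of y] D(2)
        by (auto simp: indicator_def)
      moreover have "y - l \<notin> D" if "l \<in> S" for l
      proof
        assume *: "y - l \<in> D"
        have "y - reduce M y = l" unfolding red[OF * that] by simp
        with False red[OF * that] * that show False by metis
      qed
      ultimately show ?thesis by simp
    qed
    have shift: "(\<lambda>x. x + - l) \<in> lebesgue \<rightarrow>\<^sub>M lebesgue" for l :: "real ^ 'd"
      by (rule measurable_lebesgue_plus)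
    have meas: "(\<lambda>x. indicator D (x - l) :: complex) \<in> borel_measurable lebesgue" for l
      using measurable_compose[OF shift[of l], of "indicator D :: _ \<Rightarrow> complex" borel] by simp
    have int: "integrable lebesgue (\<lambda>y. u y * indicator D (y - l))" for l
      by (rule integrable_mult_bounded_complex[OF u meas, of _ 1]) (simp add: indicator_def)
    have "(\<integral>x. indicator D x *\<^sub>R ?F x \<partial>lebesgue)
        = (\<integral>x. (\<Sum>l\<in>S. u (x + l) * indicator D (x + l - l)) \<partial>lebesgue)"
      by (intro Bochner_Integration.integral_cong) (auto simp: indicator_def)
    also have "\<dots> = (\<Sum>l\<in>S. \<integral>x. u (x + l) * indicator D (x + l - l) \<partial>lebesgue)"
      by (intro Bochner_Integration.integral_sum integrable_lebesgue_plus[OF int])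
    also have "\<dots> = (\<Sum>l\<in>S. \<integral>y. u y * indicator D (y - l) \<partial>lebesgue)"
      by (intro sum.cong refl integral_lebesgue_plus borel_measurable_integrable[OF int])
    also have "\<dots> = (\<integral>y. (\<Sum>l\<in>S. u y * indicator D (y - l)) \<partial>lebesgue)"
      by (intro Bochner_Integration.integral_sum[symmetric] int)
    also have "\<dots> = 0"
      unfolding point by (rule integral_reduce_eq_0[OF u 0 D(1)])
    finally show ?thesis .
  qed
  \<comment> \<open>A Lebesgue measurable set is a Borel set up to a null set, so the Borel case
    suffices.\<close>
  have leb: "(\<integral>x. indicator D x *\<^sub>R ?F x \<partial>lebesgue) = 0" if D: "D \<in> sets lebesgue" "D \<subseteq> B" for D
  proof -
    obtain D' N N' where N: "D = D' \<union> N" "N \<subseteq> N'" "N' \<in> null_sets lborel" "D' \<in> sets lborel"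
      using D(1) by (rule sets_completionE)
    have [measurable]: "D \<in> sets lebesgue" "D' \<in> sets lebesgue"
      using D N by auto
    have "AE x in lebesgue. x \<notin> N'"
      using N(3) by (intro AE_not_in null_sets_completionI)
    then have "AE x in lebesgue. indicator D x *\<^sub>R ?F x = indicator D' x *\<^sub>R ?F x"
      using N(1,2) by (auto simp: indicator_def elim!: eventually_mono)
    then have "(\<integral>x. indicator D x *\<^sub>R ?F x \<partial>lebesgue) = (\<integral>x. indicator D' x *\<^sub>R ?F x \<partial>lebesgue)"
      by (rule integral_cong_AE[rotated 2]) measurable
    then show ?thesis using borel[of D'] N D(2) by simp
  qed
  have "AE x in lebesgue. indicator B x *\<^sub>R ?F x = 0"
  proof (rule sigma_finite_measure.density_zero[OF sigma_finite_lebesgue])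
    show "integrable lebesgue (\<lambda>x. indicator B x *\<^sub>R ?F x)"
      using B(1) F by (rule integrable_mult_indicator)
    fix A :: "(real ^ 'd) set" assume "A \<in> sets lebesgue"
    then have "(\<integral>x. indicator (A \<inter> B) x *\<^sub>R ?F x \<partial>lebesgue) = 0"
      using B(1) by (intro leb) auto
    then show "set_lebesgue_integral lebesgue A (\<lambda>x. indicator B x *\<^sub>R ?F x) = 0"
      by (simp add: set_lebesgue_integral_def indicator_inter_arith)
  qed
  then show ?thesis by (rule eventually_mono) (auto simp: indicator_def)
qed

section \<open>Sections of a tile\<close>

lemma length_coords [simp]: "length (coords (x :: 'a ^ 'd::{finite,wellorder})) = CARD('d)"
  by (simp add: coords_def)

lemma bij_betw_index:
  "bij_betw ((!) (sorted_list_of_set UNIV)) {..<CARD('d)} (UNIV :: 'd::{finite,wellorder} set)"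
  by (rule bij_betw_nth) auto

lemma nth_coords:
  "i < CARD('d) \<Longrightarrow> coords (x :: 'a ^ 'd::{finite,wellorder}) ! i = x $ (sorted_list_of_set UNIV ! i)"
  by (simp add: coords_def)

lemma bij_betw_coords:
  "bij_betw (coords :: 'a ^ 'd::{finite,wellorder} \<Rightarrow> 'a list) UNIV {xs. length xs = CARD('d)}"
proof -
  let ?e = "(!) (sorted_list_of_set UNIV) :: nat \<Rightarrow> 'd"
  \<comment> \<open>\<open>r\<close> gives the position of an index in the increasing enumeration of
    the index type.\<close>
  obtain r where r: "\<And>i. i < CARD('d) \<Longrightarrow> r (?e i) = i" "\<And>k. r k < CARD('d)" "\<And>k. ?e (r k) = k"
    using bij_betw_inv_into_left[OF bij_betw_index] bij_betw_inv_into_right[OF bij_betw_index]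
      bij_betw_apply[OF bij_betw_inv_into[OF bij_betw_index]]
    by (metis UNIV_I lessThan_iff)
  show ?thesis
  proof (rule bij_betw_byWitness[where f' = "\<lambda>xs. \<chi> k. xs ! r k"])
    show "\<forall>x\<in>UNIV. (\<chi> k. coords x ! r k) = (x :: 'a ^ 'd::_)"
      using r by (simp add: vec_eq_iff nth_coords)
    show "\<forall>xs\<in>{xs. length xs = CARD('d)}. coords (\<chi> k. xs ! r k :: 'a ^ 'd::_) = xs"
      using r by (auto intro!: nth_equalityI simp: nth_coords)
  qed auto
qed

lemma inj_coords: "inj (coords :: 'a ^ 'd::{finite,wellorder} \<Rightarrow> 'a list)"
  using bij_betw_coords by (rule bij_betw_imp_inj_on)

text \<open>The nodes of the linear system. The minus sign comes from the conjugation in the inner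
  product.\<close>

definition shift_weight :: "real ^ 'd::{finite,wellorder} \<Rightarrow> nat ^ 'd::_ \<Rightarrow> nat \<Rightarrow> real \<Rightarrow> complex" where
  "shift_weight v q i z = cis (- (2 * pi * (coords v ! i * z / real (coords q ! i))))"

text \<open>The shift without \<open>\<eta>\<close>, which acts trivially on lattice points.\<close>

definition shift_of :: "real ^ 'd::{finite,wellorder} \<Rightarrow> nat ^ 'd::_ \<Rightarrow> int ^ 'd::_ \<Rightarrow> real ^ 'd::_" where
  "shift_of v q j = shift_matrix v q *v (\<chi> i. real_of_int (j $ i))"

lemma cis_sum: "finite A \<Longrightarrow> cis (\<Sum>i\<in>A. F i) = (\<Prod>i\<in>A. cis (F i))"
  by (induction A rule: finite_induct) (auto simp: cis_mult[symmetric])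

text \<open>The shift matrix is diagonal, so the exponential factors over the coordinates, and each
  factor is an integer power of a node.\<close>

lemma exponential_shift:
  "exponential (- shift_of v q j) l = list_monomial (shift_weight v q) (coords l) (coords j)"
proof -
  have s: "shift_of v q j $ i = v $ i / real (q $ i) * real_of_int (j $ i)" for i
    by (simp add: shift_of_def shift_matrix_def matrix_vector_mult_def if_distrib[of "\<lambda>a. a * _"]
        cong: if_cong)
  have "2 * pi * (- shift_of v q j \<bullet> l) =
      (\<Sum>i\<in>UNIV. of_int (j $ i) * (- (2 * pi * (v $ i * l $ i / real (q $ i)))))"
    by (simp add: inner_vec_def s sum_distrib_left sum_negf mult_ac)
  then have "exponential (- shift_of v q j) l =
      (\<Prod>i\<in>UNIV. cis (- (2 * pi * (v $ i * l $ i / real (q $ i)))) powi (j $ i))"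
    unfolding exponential_cis by (simp add: cis_sum cis_power_int)
  also have "\<dots> = (\<Prod>i<CARD('a). shift_weight v q i (coords l ! i) powi (coords j ! i))"
  proof -
    have "(\<Prod>i\<in>UNIV. cis (- (2 * pi * (v $ i * l $ i / real (q $ i)))) powi (j $ i)) =
      (\<Prod>i<CARD('a). cis (- (2 * pi * (v $ (sorted_list_of_set UNIV ! i) * l $ (sorted_list_of_set UNIV ! i)
        / real (q $ (sorted_list_of_set UNIV ! i))))) powi (j $ (sorted_list_of_set UNIV ! i)))"
      by (rule prod.reindex_bij_betw[OF bij_betw_index, symmetric])
    also have "\<dots> = (\<Prod>i<CARD('a). shift_weight v q i (coords l ! i) powi (coords j ! i))"
      by (intro prod.cong) (auto simp: shift_weight_def nth_coords)
    finally show ?thesis .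
  qed
  finally show ?thesis by (simp add: list_monomial_def)
qed

text \<open>Two nodes agree exactly when the phases \<open>v z / q\<close> differ by an integer;
  multiplying by \<open>q\<close> gives congruence modulo \<open>q\<close>.\<close>

lemma inj_on_shift_weight:
  fixes v :: "real ^ 'd::{finite,wellorder}"
  assumes q: "0 < coords q ! i"
    and inj: "inj_on (\<lambda>z. (coords v ! i * z) rmod real (coords q ! i)) A"
  shows "inj_on (shift_weight v q i) A"
proof (rule inj_onI)
  fix y z assume A: "y \<in> A" "z \<in> A" and eq: "shift_weight v q i y = shift_weight v q i z"
  obtain n where "- (2 * pi * (coords v ! i * z / real (coords q ! i))) =
      - (2 * pi * (coords v ! i * y / real (coords q ! i))) + of_int n * (2 * pi)"
    using eq unfolding shift_weight_def cis_eq_iff rcong_altdef by blast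
  then have "2 * pi * (coords v ! i * z / real (coords q ! i)) =
      2 * pi * (coords v ! i * y / real (coords q ! i) - of_int n)"
    by (simp add: algebra_simps)
  then have "coords v ! i * z / real (coords q ! i) = coords v ! i * y / real (coords q ! i) - of_int n"
    by (subst (asm) mult_left_cancel) simp
  then have "coords v ! i * z = coords v ! i * y + of_int (- n) * real (coords q ! i)"
    using q by (simp add: field_simps)
  then have "[coords v ! i * y = coords v ! i * z] (rmod real (coords q ! i))"
    unfolding rcong_altdef by blast
  then show "y = z" using inj A by (auto simp: rcong_def inj_on_def)
qed

definition admissible_section :: "real ^ 'd::{finite,wellorder} \<Rightarrow> nat ^ 'd::_ \<Rightarrow> real list set \<Rightarrow> bool" where
  "admissible_section v q S \<longleftrightarrow> (\<forall>l\<in>{1..CARD('d)}. \<forall>p\<in>{1..num_points S (l - 1)}.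
     card ((\<lambda>z. (coords v ! (l - 1) * z) rmod real (coords q ! (l - 1))) ` fiber_set S l p)
       = card (fiber_set S l p))"

text \<open>Equal cardinality of a finite set and its image means injectivity, and
  \<open>fiber_set_fibers\<close> replaces the numbered fibers by the fiber over an arbitrary base
  point.\<close>

lemma admissible_section_inj:
  fixes v :: "real ^ 'd::{finite,wellorder}"
  assumes adm: "admissible_section v q S" and q: "\<And>i. 0 < q $ i"
    and S: "finite S" "S \<noteq> {}" "\<And>x. x \<in> S \<Longrightarrow> length x = CARD('d)"
    and i: "i < CARD('d)" and m: "m \<in> take i ` S"
  shows "inj_on (shift_weight v q i) (fiber (take (Suc i) ` S) m)"
proof (rule inj_on_shift_weight)
  show "0 < coords q ! i" using q i by (simp add: nth_coords)
  have "fiber (take (Suc i) ` S) m \<in> fiber_set S (Suc i) ` {1..num_points S i}"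
    using fiber_set_fibers[OF S, of "Suc i"] i m by simp
  then obtain p where p: "p \<in> {1..num_points S i}" "fiber (take (Suc i) ` S) m = fiber_set S (Suc i) p"
    by blast
  have "Suc i \<in> {1..CARD('d)}" using i by simp
  then have "card ((\<lambda>z. (coords v ! i * z) rmod real (coords q ! i)) ` fiber_set S (Suc i) p)
      = card (fiber_set S (Suc i) p)"
    using adm p(1) unfolding admissible_section_def by fastforce
  moreover have "finite (fiber_set S (Suc i) p)"
    unfolding p(2)[symmetric] using S(1) by (simp add: finite_fiber)
  ultimately show "inj_on (\<lambda>z. (coords v ! i * z) rmod real (coords q ! i)) (fiber (take (Suc i) ` S) m)"
    unfolding p(2) by (intro eq_card_imp_inj_on)
qed

text \<open>\<open>shift_index_unisolvent\<close> carried over from lists to vectors by the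
  bijection \<open>coords\<close>.\<close>

proposition admissible_section_unisolvent:
  fixes v :: "real ^ 'd::{finite,wellorder}" and S :: "(real ^ 'd::_) set"
  assumes adm: "admissible_section v q (coords ` S)" and q: "\<And>i. 0 < q $ i" and S: "finite S"
    and 0: "\<And>j. coords j \<in> shift_index CARD('d) (coords ` S) \<Longrightarrow>
      (\<Sum>l\<in>S. c l * exponential (- shift_of v q j) l) = 0"
    and l: "l \<in> S"
  shows "c l = 0"
proof -
  obtain d where d: "CARD('d) = Suc d"
    by (metis card_eq_0_iff finite UNIV_not_empty not0_implies_Suc)
  let ?c = "\<lambda>m. c (inv coords m)"
  have "?c (coords l) = 0"
  proof (rule shift_index_unisolvent[where S = "coords ` S" and l = d and w = "shift_weight v q"])
    fix i m assume "i \<le> d" "m \<in> take i ` coords ` S"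
    then show "inj_on (shift_weight v q i) (fiber (take (Suc i) ` coords ` S) m)"
      using S l d by (intro admissible_section_inj[OF adm q]) auto
  next
    fix j assume j: "j \<in> shift_index (Suc d) (coords ` S)"
    then have "length j = CARD('d)"
      using length_shift_index[of "coords ` S" j "Suc d"] S d by simp
    then obtain j' :: "int ^ 'd::_" where j': "j = coords j'"
      using bij_betw_coords unfolding bij_betw_def by blast
    have "(\<Sum>m\<in>coords ` S. ?c m * list_monomial (shift_weight v q) m j) =
        (\<Sum>l\<in>S. c l * exponential (- shift_of v q j') l)"
      unfolding exponential_shift j'
      by (subst sum.reindex) (use inj_coords in \<open>auto simp: inj_on_def inv_f_f[OF inj_coords]\<close>)
    then show "(\<Sum>m\<in>coords ` S. ?c m * list_monomial (shift_weight v q) m j) = 0"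
      using 0[of j'] j unfolding j' d by simp
  qed (use S l d in auto)
  then show ?thesis by (simp add: inv_f_f[OF inj_coords])
qed

section \<open>Measurability, finiteness and integrability\<close>

lemma fund_domain_reduce: "invertible M \<Longrightarrow> fund_domain M = {x. reduce M x = x}"
proof (intro equalityI subsetI)
  fix x assume "invertible M" "x \<in> fund_domain M"
  then show "x \<in> {x. reduce M x = x}" by (simp add: reduce_eq lattice_of_0)
next
  fix x assume "x \<in> {x. reduce M x = x}"
  then have "x = M *v (\<chi> i. frac ((matrix_inv M *v x) $ i))" by (simp add: reduce_def)
  then show "x \<in> fund_domain M"
    unfolding fund_domain_def by (rule image_eqI) (simp add: frac_lt_1)
qed

lemma fund_domain_sets:
  fixes M :: "real ^ 'd ^ 'd"
  assumes "invertible M"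
  shows "fund_domain M \<in> sets borel"
proof -
  have "(\<lambda>x. untorus M (torus_map M x)) \<in> borel_measurable borel" by measurable
  then have [measurable]: "reduce M \<in> borel_measurable borel"
    by (simp add: untorus_torus_map[abs_def])
  show ?thesis unfolding fund_domain_reduce[OF assms] by measurable
qed

text \<open>Prescribing the section is one measurable membership condition for each of countably
  many lattice points.\<close>

lemma section_sets:
  assumes [measurable]: "\<Omega> \<in> sets lebesgue"
  shows "{x. lattice_section M \<Omega> x = S} \<in> sets lebesgue"
proof (cases "S \<subseteq> lattice_of M")
  case True
  have "{x. (x + l \<in> \<Omega>) = (l \<in> S)} \<in> sets lebesgue" for l
  proof -
    have "(\<lambda>x. x + l) -` \<Omega> \<in> sets lebesgue"
      using measurable_sets[OF measurable_lebesgue_plus assms, of l] by simp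
    moreover have "{x. (x + l \<in> \<Omega>) = (l \<in> S)} =
        (if l \<in> S then (\<lambda>x. x + l) -` \<Omega> else - ((\<lambda>x. x + l) -` \<Omega>))"
      by auto
    ultimately show ?thesis by (auto simp: Compl_eq_Diff_UNIV)
  qed
  moreover have "{x. lattice_section M \<Omega> x = S} = (\<Inter>l\<in>lattice_of M. {x. (x + l \<in> \<Omega>) = (l \<in> S)})"
    using True by (auto simp: lattice_section_def)
  moreover have "lattice_of M \<noteq> {}" using lattice_of_0 by blast
  ultimately show ?thesis
    by (simp only:) (intro sets.countable_INT'' countable_lattice_of; simp)
next
  case False
  then have "{x. lattice_section M \<Omega> x = S} = {}" by (auto simp: lattice_section_def)
  then show ?thesis by simp
qed

text \<open>Otherwise the constant 1 would be summable over an infinite set.\<close>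

lemma finite_if_has_sum_indicator:
  assumes "((\<lambda>l. indicat_real A (g l)) has_sum s) L"
  shows "finite {l \<in> L. g l \<in> A}"
proof (rule ccontr)
  have "(\<lambda>l. indicat_real A (g l)) summable_on L"
    using assms by (auto simp: summable_on_def)
  then have "(\<lambda>l. indicat_real A (g l)) summable_on {l \<in> L. g l \<in> A}"
    by (rule summable_on_subset_banach) auto
  then have "(\<lambda>l. 1 :: real) summable_on {l \<in> L. g l \<in> A}"
    by (rule summable_on_cong[THEN iffD1, rotated]) auto
  moreover assume "infinite {l \<in> L. g l \<in> A}"
  ultimately show False using infsum_diverge_constant[of "{l \<in> L. g l \<in> A}" "1 :: real"] by simp
qed

text \<open>The tile condition counts the points \<open>x - l\<close>, the section the points
  \<open>x + l\<close>; negation of the lattice passes between them.\<close>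

lemma k_tile_finite_section:
  assumes "k_tile k M \<Omega>"
  shows "AE x in lebesgue. finite (lattice_section M \<Omega> x)"
  using assms unfolding k_tile_def
proof (rule eventually_mono)
  fix x assume "((\<lambda>l. indicat_real \<Omega> (x - l)) has_sum real k) (lattice_of M)"
  then have "finite {l \<in> lattice_of M. x - l \<in> \<Omega>}" by (rule finite_if_has_sum_indicator)
  moreover have "lattice_section M \<Omega> x \<subseteq> uminus ` {l \<in> lattice_of M. x - l \<in> \<Omega>}"
  proof
    fix l assume "l \<in> lattice_section M \<Omega> x"
    then show "l \<in> uminus ` {l \<in> lattice_of M. x - l \<in> \<Omega>}"
      unfolding lattice_section_def by (intro image_eqI[of _ _ "- l"]) (simp_all add: lattice_of_minus)
  qed
  ultimately show "finite (lattice_section M \<Omega> x)" by (meson finite_imageI finite_subset)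
qed

lemma integrable_if_square_integrable:
  fixes \<Omega> :: "(real ^ 'd) set"
  assumes \<Omega>: "\<Omega> \<in> sets lebesgue" "emeasure lebesgue \<Omega> < \<infinity>" and f: "f square_integrable_on \<Omega>"
  shows "integrable (lebesgue_on \<Omega>) f"
proof (rule Bochner_Integration.integrable_bound)
  interpret finite_measure "lebesgue_on \<Omega>"
    using \<Omega> by (intro finite_measureI) (simp add: emeasure_restrict_space)
  show "integrable (lebesgue_on \<Omega>) (\<lambda>x. 1 + (cmod (f x))\<^sup>2)"
    using f by (simp add: square_integrable_on_def)
  have "t \<le> 1 + t\<^sup>2" for t :: real
    using sum_power2_ge_zero[of "t - 1" t] by (simp add: power2_eq_square algebra_simps)
  then show "AE x in lebesgue_on \<Omega>. norm (f x) \<le> norm (1 + (cmod (f x))\<^sup>2)"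
    by (intro AE_I2) simp
qed (use f in \<open>simp add: square_integrable_on_def\<close>)


lemma inner_on_eq_lebesgue:
  assumes "\<Omega> \<in> sets lebesgue"
  shows "inner_on \<Omega> f (exponential l) = (\<integral>x. indicator \<Omega> x *\<^sub>R (f x * exponential (- l) x) \<partial>lebesgue)"
  unfolding inner_on_def using assms by (simp add: integral_restrict_space cnj_exponential)

text \<open>Fixing the value \<open>S\<close> of the section makes the frequency set constant, so that the moments
  below vanish for a single function and periodization applies.\<close>

lemma section_sum_eq_0:
  fixes M :: "real ^ 'd ^ 'd" and g :: "real ^ 'd \<Rightarrow> complex"
  assumes M: "invertible M" and \<Omega>: "\<Omega> \<in> sets lebesgue" and g: "integrable lebesgue g"
    and supp: "\<And>x. x \<notin> \<Omega> \<Longrightarrow> g x = 0"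
    and S: "finite S" "S \<subseteq> lattice_of M"
    and 0: "\<And>\<mu>. \<mu> \<in> dual_lattice_of M \<Longrightarrow> (\<integral>x. g x * exponential (- (\<mu> + a)) x \<partial>lebesgue) = 0"
  shows "AE x\<in>fund_domain M in lebesgue. lattice_section M \<Omega> x = S \<longrightarrow>
    (\<Sum>l\<in>S. g (x + l) * exponential (- a) l) = 0"
proof -
  let ?u = "\<lambda>x. g x * exponential (- a) x"
  let ?B = "fund_domain M \<inter> {x. lattice_section M \<Omega> x = S}"
  have "AE x\<in>?B in lebesgue. (\<Sum>l\<in>S. ?u (x + l)) = 0"
  proof (rule periodization_eq_0)
    show "integrable lebesgue ?u"
      by (rule integrable_mult_bounded_complex[OF g, of _ 1]) (auto intro: measurable_completion)
    show "(\<integral>x. ?u x * exponential \<mu> x \<partial>lebesgue) = 0" if "\<mu> \<in> dual_lattice_of M" for \<mu>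
    proof -
      \<comment> \<open>The coefficient of \<open>?u\<close> at \<open>\<mu>\<close> is the
        hypothesis \<open>0\<close> at \<open>- \<mu>\<close>, since the exponential there carries a
        minus sign.\<close>
      have "- \<mu> \<in> dual_lattice_of M"
        using that unfolding dual_lattice_of_def by (rule lattice_of_minus)
      from 0[OF this] show ?thesis
        by (simp add: mult.assoc exponential_add[symmetric] add.commute)
    qed
    show "?B \<in> sets lebesgue"
      using fund_domain_sets[OF M] section_sets[OF \<Omega>] by (intro sets.Int) auto
    show "?u (x + l) = 0" if "x \<in> ?B" "l \<in> lattice_of M - S" for x l
      using that supp[of "x + l"] by (auto simp: lattice_section_def)
  qed (use M S in auto)
  moreover have "(\<Sum>l\<in>S. ?u (x + l)) = exponential (- a) x * (\<Sum>l\<in>S. g (x + l) * exponential (- a) l)" for x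
    unfolding sum_distrib_left by (intro sum.cong) (simp_all add: exponential_add_right mult_ac)
  moreover have "exponential (- a) x \<noteq> 0" for x
    using norm_exponential[of "- a" x] by force
  ultimately show ?thesis by (auto elim!: eventually_mono)
qed

theorem theorem3p2:
  fixes M :: "real ^ 'd::{finite,wellorder} ^ 'd::_"
    and \<Omega> :: "(real ^ 'd::_) set"
    and v \<eta> :: "real ^ 'd::_"
    and q :: "nat ^ 'd::_"
    and k :: nat
    and f h :: "real ^ 'd::_ \<Rightarrow> complex"
  assumes "invertible M"
    and "\<Omega> \<in> sets lebesgue" and "0 < emeasure lebesgue \<Omega>" and "emeasure lebesgue \<Omega> < \<infinity>"
    and "k_tile k M \<Omega>"
    and "\<And>i. 0 < q $ i"
    and "weakly_admissible v q M \<Omega>"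
    and "\<eta> \<in> dual_lattice_of M"
    and "f square_integrable_on \<Omega>" and "h square_integrable_on \<Omega>"
  shows "AE y\<in>\<Omega> in lebesgue. \<forall>x\<in>fund_domain M. y - x \<in> lattice_of M \<longrightarrow>
    (\<forall>l\<in>frequencies v q \<eta> M \<Omega> x.
       inner_on \<Omega> f (exponential l) = inner_on \<Omega> h (exponential l)) \<longrightarrow> f y = h y"
proof -
  note M = assms(1) and \<Omega> = assms(2)
  let ?K = "\<lambda>S :: (real ^ 'd::_) set. {j :: int ^ 'd::_. coords j \<in> shift_index CARD('d) (coords ` S)}"
  let ?a = "\<lambda>j. shift_of v q j + \<eta>"
  \<comment> \<open>Extension by zero turns the difference into an integrable function on the whole
    space.\<close>
  define g where "g x = indicat_real \<Omega> x *\<^sub>R (f x - h x)" for x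
  \<comment> \<open>Agreement of the data expressed through the section alone, without reference to
    \<open>x\<close>.\<close>
  define agree where "agree S \<longleftrightarrow> (\<forall>j\<in>?K S. \<forall>\<mu>\<in>dual_lattice_of M.
    inner_on \<Omega> f (exponential (\<mu> + ?a j)) = inner_on \<Omega> h (exponential (\<mu> + ?a j)))" for S
  have agree: "agree (lattice_section M \<Omega> x) \<longleftrightarrow> (\<forall>l\<in>frequencies v q \<eta> M \<Omega> x.
       inner_on \<Omega> f (exponential l) = inner_on \<Omega> h (exponential l))" for x
    unfolding agree_def frequencies_def lattice_shifts_def shift_of_def by blast
  have int: "integrable lebesgue (\<lambda>x. indicat_real \<Omega> x *\<^sub>R F x)" if "F square_integrable_on \<Omega>" for F
    using integrable_if_square_integrable[OF \<Omega> assms(4) that] \<Omega> by (simp add: integrable_restrict_space)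
  have g: "integrable lebesgue g"
    unfolding g_def scaleR_diff_right using int assms(9,10) by (intro Bochner_Integration.integrable_diff)
  have moments: "(\<integral>x. g x * exponential (- b) x \<partial>lebesgue)
      = inner_on \<Omega> f (exponential b) - inner_on \<Omega> h (exponential b)" for b
  proof -
    have F: "integrable lebesgue (\<lambda>x. indicat_real \<Omega> x *\<^sub>R (F x * exponential (- b) x))"
      if "F square_integrable_on \<Omega>" for F
      unfolding mult_scaleR_left[symmetric]
      by (rule integrable_mult_bounded_complex[OF int[OF that], of _ 1]) (auto intro: measurable_completion)
    show ?thesis
      unfolding inner_on_eq_lebesgue[OF \<Omega>]
      by (subst Bochner_Integration.integral_diff[symmetric])
        (use F assms(9,10) in \<open>simp_all add: g_def algebra_simps\<close>)
  qed
  let ?Fin = "{S. finite S \<and> S \<subseteq> lattice_of M}"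
  \<comment> \<open>The exceptional null set depends on \<open>S\<close> and \<open>j\<close>. Both
    range over countable sets, so one null set serves all of them.\<close>
  have "AE x in lebesgue. \<forall>S\<in>?Fin. \<forall>j\<in>UNIV. x \<in> fund_domain M \<longrightarrow> agree S \<longrightarrow> j \<in> ?K S \<longrightarrow>
      lattice_section M \<Omega> x = S \<longrightarrow> (\<Sum>l\<in>S. g (x + l) * exponential (- ?a j) l) = 0"
  proof (subst AE_ball_countable, use countable_lattice_of in \<open>rule countable_Collect_finite_subset\<close>,
      intro ballI, subst AE_ball_countable, rule countableI_type, intro ballI)
    fix S j assume S: "S \<in> ?Fin"
    show "AE x in lebesgue. x \<in> fund_domain M \<longrightarrow> agree S \<longrightarrow> j \<in> ?K S \<longrightarrow>
      lattice_section M \<Omega> x = S \<longrightarrow> (\<Sum>l\<in>S. g (x + l) * exponential (- ?a j) l) = 0"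
    proof (cases "agree S \<and> j \<in> ?K S")
      case True
      have "AE x\<in>fund_domain M in lebesgue. lattice_section M \<Omega> x = S \<longrightarrow>
          (\<Sum>l\<in>S. g (x + l) * exponential (- ?a j) l) = 0"
      proof (rule section_sum_eq_0[OF M \<Omega> g])
        show "(\<integral>x. g x * exponential (- (\<mu> + ?a j)) x \<partial>lebesgue) = 0" if "\<mu> \<in> dual_lattice_of M" for \<mu>
          unfolding moments using True that unfolding agree_def by simp
      qed (use S in \<open>auto simp: g_def\<close>)
      then show ?thesis by (rule eventually_mono) blast
    next
      case False
      then show ?thesis by (intro AE_I2) blast
    qed
  qed
  moreover have "AE x in lebesgue. finite (lattice_section M \<Omega> x)"
    using assms(5) by (rule k_tile_finite_section)
  moreover have "AE x\<in>fund_domain M in lebesgue. admissible_section v q (coords ` lattice_section M \<Omega> x)"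
    using assms(7) unfolding weakly_admissible_def admissible_section_def Let_def .
  ultimately have "AE x in lebesgue. x \<in> fund_domain M \<longrightarrow> agree (lattice_section M \<Omega> x) \<longrightarrow>
      (\<forall>l\<in>lattice_section M \<Omega> x. g (x + l) = 0)"
  proof eventually_elim
    case (elim x)
    let ?S = "lattice_section M \<Omega> x"
    show ?case
    proof (intro impI ballI)
      fix l assume x: "x \<in> fund_domain M" "agree ?S" and l: "l \<in> ?S"
      have S: "?S \<in> ?Fin" using elim(2) by (auto simp: lattice_section_def)
      show "g (x + l) = 0"
      proof (rule admissible_section_unisolvent[of v q ?S "\<lambda>l. g (x + l)"])
        fix j :: "int ^ 'd::_" assume "coords j \<in> shift_index CARD('d) (coords ` ?S)"
        then have "(\<Sum>l\<in>?S. g (x + l) * exponential (- ?a j) l) = 0"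
          using elim(1) S x by blast
        \<comment> \<open>\<open>\<eta>\<close> pairs with lattice vectors to integers, so its
          exponential is 1 on the section.\<close>
        moreover have "exponential (- ?a j) l = exponential (- shift_of v q j) l" if "l \<in> ?S" for l
        proof -
          have "\<eta> \<bullet> l \<in> \<int>"
            using inner_dual_lattice[OF M assms(8)] that by (simp add: lattice_section_def)
          then obtain n where "\<eta> \<bullet> l = of_int n" by (auto elim: Ints_cases)
          then have "exponential (- \<eta>) l = 1"
            by (auto simp: exponential_cis cis_eq_1_iff intro!: exI[of _ "- n"])
          then show ?thesis using exponential_add[of "- shift_of v q j" "- \<eta>" l] by simp
        qed
        ultimately show "(\<Sum>l\<in>?S. g (x + l) * exponential (- shift_of v q j) l) = 0"
          by simp
      qed (use elim x l assms(6) in auto)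
    qed
  qed
  \<comment> \<open>The passage from base points \<open>x\<close> to points
    \<open>y = x + l\<close>: the statement is translated by each of the countably many lattice
    vectors, which preserves null sets.\<close>
  then have "AE y in lebesgue. \<forall>l\<in>lattice_of M. y + - l \<in> fund_domain M \<longrightarrow>
      agree (lattice_section M \<Omega> (y + - l)) \<longrightarrow> (\<forall>m\<in>lattice_section M \<Omega> (y + - l). g (y + - l + m) = 0)"
    by (subst AE_ball_countable[OF countable_lattice_of]) (intro ballI AE_lebesgue_plus)
  then show ?thesis
  proof eventually_elim
    case (elim y)
    show ?case
    proof (intro impI ballI)
      fix x assume y: "y \<in> \<Omega>" and x: "x \<in> fund_domain M" "y - x \<in> lattice_of M"
        and ag: "\<forall>l\<in>frequencies v q \<eta> M \<Omega> x.
          inner_on \<Omega> f (exponential l) = inner_on \<Omega> h (exponential l)"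
      have "y + - (y - x) = x" by simp
      moreover have "y - x \<in> lattice_section M \<Omega> x" using y x by (simp add: lattice_section_def)
      ultimately have "g (x + (y - x)) = 0"
        using bspec[OF elim x(2)] x ag agree[of x] by metis
      then show "f y = h y" using y by (simp add: g_def)
    qed
  qed
qed

end
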